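(* Let $X$ and $Y$ be uniformly locally finite metric spaces, and $\Phi\colon\mathrm{C}^*_u(X)\to\mathrm{C}^*_u(Y)$ be an embedding. Assume that either (i) $\Phi$ is compact preserving, or (ii) $Y$ has property A. Then there exists a projection $p\in\mathrm{C}^*_u(Y)$ which commutes with every element of $\Phi(\mathrm{C}^*_u(X))$ such that \[a\in\mathrm{C}^*_u(X)\mapsto p\Phi(a)p\in\mathrm{C}^*_u(Y)\] is a nonzero strongly continuous $^*$-homomorphism.
   Context: A metric space $(X,d)$ is uniformly locally finite if $\sup_{x\in X}|B_r(x)|<\infty$ for all $r>0$. An operator $a\in\mathcal{B}(\ell_2(X))$ has finite propagation if there is $r>0$ with $\langle a\delta_x,\delta_y\rangle=0$ whenever $d(x,y)>r$, where $(\delta_x)_{x\in X}$ is the canonical basis. The uniform Roe algebra $\mathrm{C}^*_u(X)$ is the norm closure in $\mathcal{B}(\ell_2(X))$ of the finite propagation operators. An embedding is an injective $^*$-homomorphism (not necessarily unital). $\Phi$ is compact preserving if $\Phi(a)$ is compact for every compact $a\in\mathrm{C}^*_u(X)$. A map $\Psi\colon\mathrm{C}^*_u(X)\to\mathrm{C}^*_u(Y)$ is strongly continuous if whenever a sequence $(a_k)_k$ in $\mathrm{C}^*_u(X)$ converges to $a\in\mathrm{C}^*_u(X)$ in the strong operator topology, $(\Psi(a_k))_k$ converges to $\Psi(a)$ in the strong operator topology. Property A (Yu): $(Y,\partial)$ has property A if for all $r,\varepsilon>0$ there are $R>0$ and finite sets $A_x\subseteq Y\times\mathbb{N}$ ($x\in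 Y$) such that $(x,1)\in A_x$ for all $x$; $|A_x\triangle A_y|/|A_x\cap A_y|<\varepsilon$ whenever $\partial(x,y)\leq r$; and $\partial(y,z)\leq R$ whenever $(y,m),(z,n)\in A_x$ for some $x$. *)

theory Defs
  imports "HOL-Analysis.Analysis"
begin

text \<open>Metric spaces are types of class \<open>metric_space\<close>; in particular they are nonempty.\<close>

typedef 'a ell2 = "{f :: 'a \<Rightarrow> complex. (\<lambda>x. (cmod (f x))\<^sup>2) summable_on UNIV}"
  morphisms coord Abs_ell2
  by (rule exI[of _ "\<lambda>_. 0"]) simp

setup_lifting type_definition_ell2

lemma ell2_mult_summable:
  fixes f g :: "'a \<Rightarrow> complex"
  assumes "(\<lambda>x. (cmod (f x))\<^sup>2) summable_on UNIV" "(\<lambda>x. (cmod (g x))\<^sup>2) summable_on UNIV"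
  shows "(\<lambda>x. f x * cnj (g x)) summable_on UNIV"
proof -
  have "(\<lambda>x. norm (f x * cnj (g x))) summable_on UNIV"
    by (rule abs_summable_product)
      (use assms in \<open>simp_all add: power2_eq_square norm_mult\<close>)
  then show ?thesis by (rule abs_summable_summable)
qed

lemma ell2_add_summable:
  fixes f g :: "'a \<Rightarrow> complex"
  assumes "(\<lambda>x. (cmod (f x))\<^sup>2) summable_on UNIV" "(\<lambda>x. (cmod (g x))\<^sup>2) summable_on UNIV"
  shows "(\<lambda>x. (cmod (f x + g x))\<^sup>2) summable_on UNIV"
proof (rule summable_on_comparison_test)
  show "(\<lambda>x. 2 * (cmod (f x))\<^sup>2 + 2 * (cmod (g x))\<^sup>2) summable_on UNIV"
    by (intro summable_on_add summable_on_cmult_right assms)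
  fix x
  have "(cmod (f x + g x))\<^sup>2 \<le> (cmod (f x) + cmod (g x))\<^sup>2"
    by (intro power_mono norm_triangle_ineq) auto
  also have "\<dots> \<le> 2 * (cmod (f x))\<^sup>2 + 2 * (cmod (g x))\<^sup>2"
    using sum_squares_bound[of "cmod (f x)" "cmod (g x)"] by (simp add: power2_sum)
  finally show "(cmod (f x + g x))\<^sup>2 \<le> 2 * (cmod (f x))\<^sup>2 + 2 * (cmod (g x))\<^sup>2" .
qed auto

lemma ell2_scale_summable:
  fixes f :: "'a \<Rightarrow> complex"
  assumes "(\<lambda>x. (cmod (f x))\<^sup>2) summable_on UNIV"
  shows "(\<lambda>x. (cmod (c * f x))\<^sup>2) summable_on UNIV"
  using summable_on_cmult_right[OF assms, of "(cmod c)\<^sup>2"] by (simp add: norm_mult power_mult_distrib)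

instantiation ell2 :: (type) real_vector
begin

lift_definition zero_ell2 :: "'a ell2" is "\<lambda>_. 0" by simp
lift_definition plus_ell2 :: "'a ell2 \<Rightarrow> 'a ell2 \<Rightarrow> 'a ell2" is "\<lambda>f g x. f x + g x"
  by (rule ell2_add_summable)
lift_definition uminus_ell2 :: "'a ell2 \<Rightarrow> 'a ell2" is "\<lambda>f x. - f x" by simp
lift_definition minus_ell2 :: "'a ell2 \<Rightarrow> 'a ell2 \<Rightarrow> 'a ell2" is "\<lambda>f g x. f x - g x"
proof -
  fix f g :: "'a \<Rightarrow> complex"
  assume "(\<lambda>x. (cmod (f x))\<^sup>2) summable_on UNIV" "(\<lambda>x. (cmod (g x))\<^sup>2) summable_on UNIV"
  then show "(\<lambda>x. (cmod (f x - g x))\<^sup>2) summable_on UNIV"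
    using ell2_add_summable[of f "\<lambda>x. - g x"] by simp
qed
lift_definition scaleR_ell2 :: "real \<Rightarrow> 'a ell2 \<Rightarrow> 'a ell2" is "\<lambda>r f x. of_real r * f x"
  by (rule ell2_scale_summable)

instance
  by standard (transfer; simp add: algebra_simps)+

end

lift_definition scaleC_ell2 :: "complex \<Rightarrow> 'a ell2 \<Rightarrow> 'a ell2" is "\<lambda>c f x. c * f x"
  by (rule ell2_scale_summable)

lift_definition cinner :: "'a ell2 \<Rightarrow> 'a ell2 \<Rightarrow> complex"
  is "\<lambda>f g. \<Sum>\<^sub>\<infinity>x. f x * cnj (g x)" .

lift_definition delta :: "'a \<Rightarrow> 'a ell2" is "\<lambda>x y. if y = x then 1 else 0"
proof -
  fix x :: 'a
  have "(\<lambda>y. (cmod (if y = x then 1 else 0))\<^sup>2) summable_on UNIV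
    \<longleftrightarrow> (\<lambda>y. (cmod (if y = x then 1 else 0))\<^sup>2) summable_on {x}"
    by (rule summable_on_cong_neutral) auto
  then show "(\<lambda>y. (cmod (if y = x then 1 else 0))\<^sup>2) summable_on UNIV" by simp
qed

lemma cinner_delta: "cinner u (delta x) = coord u x"
proof -
  have "cinner u (delta x) = (\<Sum>\<^sub>\<infinity>y\<in>{x}. coord u y)"
    unfolding cinner.rep_eq delta.rep_eq by (rule infsum_cong_neutral) auto
  then show ?thesis by simp
qed

lemma cinner_add_left: "cinner (u + v) w = cinner u w + cinner v w"
  by transfer (simp add: distrib_right infsum_add ell2_mult_summable)

lemma cinner_commute: "cinner u v = cnj (cinner v u)"
  by transfer (simp add: mult.commute flip: infsum_cnj)

lemma cinner_scaleC_left: "cinner (scaleC_ell2 c u) v = c * cinner u v"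
  by transfer (simp add: mult.assoc infsum_cmult_right ell2_mult_summable)

lemma scaleR_scaleC_ell2: "r *\<^sub>R (u :: 'a ell2) = scaleC_ell2 (of_real r) u"
  by transfer simp

lemma cinner_self: "cinner u u = of_real (\<Sum>\<^sub>\<infinity>x. (cmod (coord u x))\<^sup>2)"
proof -
  have "cinner u u = (\<Sum>\<^sub>\<infinity>x. complex_of_real ((cmod (coord u x))\<^sup>2))"
    unfolding cinner.rep_eq by (rule infsum_cong) (simp only: complex_norm_square)
  also have "\<dots> = of_real (\<Sum>\<^sub>\<infinity>x. (cmod (coord u x))\<^sup>2)"
    using has_sum_bounded_linear[OF bounded_linear_of_real has_sum_infsum] coord[of u]
    by (intro infsumI) fast
  finally show ?thesis .
qed

text \<open>The real inner product is the real part of the complex one; both induce the \<open>\<ell>\<^sub>2\<close>-norm.\<close>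

instantiation ell2 :: (type) real_inner
begin

definition inner_ell2 :: "'a ell2 \<Rightarrow> 'a ell2 \<Rightarrow> real"
  where "inner_ell2 u v = Re (cinner u v)"
definition norm_ell2 :: "'a ell2 \<Rightarrow> real"
  where "norm_ell2 u = sqrt (\<Sum>\<^sub>\<infinity>x. (cmod (coord u x))\<^sup>2)"
definition sgn_ell2 :: "'a ell2 \<Rightarrow> 'a ell2"
  where "sgn_ell2 u = u /\<^sub>R norm u"
definition dist_ell2 :: "'a ell2 \<Rightarrow> 'a ell2 \<Rightarrow> real"
  where "dist_ell2 u v = norm (u - v)"
definition uniformity_ell2 :: "('a ell2 \<times> 'a ell2) filter"
  where "uniformity_ell2 = (INF e\<in>{0<..}. principal {(u, v). dist u v < e})"
definition open_ell2 :: "'a ell2 set \<Rightarrow> bool"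
  where "open_ell2 U \<longleftrightarrow> (\<forall>u\<in>U. \<forall>\<^sub>F (u', v) in uniformity. u' = u \<longrightarrow> v \<in> U)"

instance
proof
  fix u v w :: "'a ell2" and r :: real
  show "inner u v = inner v u"
    unfolding inner_ell2_def by (subst cinner_commute) simp
  show "inner (u + v) w = inner u w + inner v w"
    by (simp add: inner_ell2_def cinner_add_left)
  show "inner (r *\<^sub>R u) v = r * inner u v"
    by (simp add: inner_ell2_def scaleR_scaleC_ell2 cinner_scaleC_left)
  show "0 \<le> inner u u"
    by (simp add: inner_ell2_def cinner_self infsum_nonneg)
  show "norm u = sqrt (inner u u)"
    by (simp add: inner_ell2_def cinner_self norm_ell2_def)
  show "inner u u = 0 \<longleftrightarrow> u = 0"
  proof
    assume "inner u u = 0"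
    then have *: "(\<Sum>\<^sub>\<infinity>x. (cmod (coord u x))\<^sup>2) = 0"
      by (simp add: inner_ell2_def cinner_self)
    have "(cmod (coord u x))\<^sup>2 = 0" for x
      using nonneg_infsum_le_0D[of "\<lambda>x. (cmod (coord u x))\<^sup>2" UNIV x] * coord[of u] by simp
    then show "u = 0"
      by transfer auto
  qed (simp add: inner_ell2_def cinner_self zero_ell2.rep_eq)
qed (simp_all only: sgn_ell2_def dist_ell2_def uniformity_ell2_def open_ell2_def)

end

text \<open>Library operators on \<open>\<ell>\<^sub>2\<close> are real-linear; \<open>\<B>(\<ell>\<^sub>2(X))\<close> is the set of
  those that are also complex-linear.\<close>

type_synonym 'a ell2_op = "'a ell2 \<Rightarrow>\<^sub>L 'a ell2"

definition bounded_ops :: "'a ell2_op set"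
  where "bounded_ops = {a. \<forall>c u. blinfun_apply a (scaleC_ell2 c u) = scaleC_ell2 c (blinfun_apply a u)}"

lemma norm_scaleC_ell2: "norm (scaleC_ell2 c u) = cmod c * norm u"
proof -
  have "(\<Sum>\<^sub>\<infinity>x. (cmod (coord (scaleC_ell2 c u) x))\<^sup>2)
    = (\<Sum>\<^sub>\<infinity>x. (cmod c)\<^sup>2 * (cmod (coord u x))\<^sup>2)"
    by (simp only: scaleC_ell2.rep_eq norm_mult power_mult_distrib)
  also have "\<dots> = (cmod c)\<^sup>2 * (\<Sum>\<^sub>\<infinity>x. (cmod (coord u x))\<^sup>2)"
    by (rule infsum_cmult_right) (use coord[of u] in simp)
  finally show ?thesis
    by (simp only: norm_ell2_def real_sqrt_mult real_sqrt_abs abs_norm_cancel)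
qed

lemma bounded_linear_scaleC_ell2: "bounded_linear (scaleC_ell2 c)"
proof (rule bounded_linear_intro)
  show "norm (scaleC_ell2 c u) \<le> norm u * cmod c" for u :: "'a ell2"
    by (simp add: norm_scaleC_ell2)
qed (transfer, simp add: algebra_simps)+

definition scaleC_op :: "complex \<Rightarrow> 'a ell2_op \<Rightarrow> 'a ell2_op"
  where "scaleC_op c a = Blinfun (\<lambda>u. scaleC_ell2 c (blinfun_apply a u))"

lemma scaleC_op_apply: "blinfun_apply (scaleC_op c a) u = scaleC_ell2 c (blinfun_apply a u)"
  unfolding scaleC_op_def
  by (subst bounded_linear_Blinfun_apply)
    (rule bounded_linear_compose[OF bounded_linear_scaleC_ell2 blinfun.bounded_linear_right], rule refl)

text \<open>Hilbert space adjoint; see \<open>adj_props\<close> below for existence and uniqueness on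
  \<open>bounded_ops\<close>.\<close>

definition adj :: "'a ell2_op \<Rightarrow> 'a ell2_op"
  where "adj a = (THE b. \<forall>u v. cinner (blinfun_apply a u) v = cinner u (blinfun_apply b v))"

lemma adj_eqI:
  assumes "\<And>u v. cinner (blinfun_apply a u) v = cinner u (blinfun_apply b v)"
  shows "adj a = b"
  unfolding adj_def
proof (rule the_equality)
  fix b' :: "'a ell2_op"
  assume b': "\<forall>u v. cinner (blinfun_apply a u) v = cinner u (blinfun_apply b' v)"
  have "coord (blinfun_apply b' v) x = coord (blinfun_apply b v) x" for v x
  proof -
    have "cinner (delta x) (blinfun_apply b' v) = cinner (delta x) (blinfun_apply b v)"
      using b' assms by simp
    then have "cinner (blinfun_apply b' v) (delta x) = cinner (blinfun_apply b v) (delta x)"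
      by (simp add: cinner_commute[of _ "delta x"])
    then show ?thesis by (simp add: cinner_delta)
  qed
  then show "b' = b"
    by (intro blinfun_eqI) (simp add: coord_inject[symmetric] ext)
qed (use assms in auto)

lemma cinner_bound: "cmod (cinner u v) \<le> norm u * norm v"
proof -
  define z where "z = cinner u v"
  define c where "c = cnj (sgn z)"
  have "z * cnj z = of_real (cmod z) * of_real (cmod z)"
    by (simp only: complex_norm_square[symmetric] power2_eq_square of_real_mult)
  then have "c * z = of_real (cmod z)"
    unfolding c_def sgn_eq by (cases "z = 0") (simp_all add: mult.commute)
  then have "c * cinner u v = of_real (cmod (cinner u v))"
    by (simp only: z_def)
  then have "cmod (cinner u v) = inner (scaleC_ell2 c u) v"
    by (simp add: inner_ell2_def cinner_scaleC_left)
  also have "\<dots> \<le> norm (scaleC_ell2 c u) * norm v"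
    by (rule norm_cauchy_schwarz)
  also have "\<dots> \<le> norm u * norm v"
    by (intro mult_right_mono) (auto simp: norm_scaleC_ell2 c_def norm_sgn)
  finally show ?thesis .
qed

definition trunc :: "'a set \<Rightarrow> 'a ell2 \<Rightarrow> 'a ell2"
  where "trunc F u = (\<Sum>x\<in>F. scaleC_ell2 (coord u x) (delta x))"

lemma coord_sum: "coord (\<Sum>x\<in>F. f x) y = (\<Sum>x\<in>F. coord (f x) y)"
  by (induction F rule: infinite_finite_induct) (auto simp: zero_ell2.rep_eq plus_ell2.rep_eq)

lemma coord_sum_delta:
  "finite F \<Longrightarrow> coord (\<Sum>x\<in>F. scaleC_ell2 (c x) (delta x)) y = (if y \<in> F then c y else 0)"
proof -
  have "c x * (if y = x then 1 else 0) = (if x = y then c x else 0)" for x by auto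
  then show "finite F \<Longrightarrow> ?thesis"
    by (simp add: coord_sum scaleC_ell2.rep_eq delta.rep_eq sum.delta')
qed

lemma norm_power2_ell2: "(norm u)\<^sup>2 = (\<Sum>\<^sub>\<infinity>x. (cmod (coord u x))\<^sup>2)"
  by (simp add: norm_ell2_def infsum_nonneg)

lemma trunc_tendsto: "((\<lambda>F. trunc F u) \<longlongrightarrow> u) (finite_subsets_at_top UNIV)"
proof -
  let ?f = "\<lambda>x. (cmod (coord u x))\<^sup>2"
  have S: "?f summable_on UNIV" using coord[of u] by simp
  have eq: "(norm (trunc F u - u))\<^sup>2 = infsum ?f UNIV - sum ?f F" if "finite F" for F
  proof -
    have "(norm (trunc F u - u))\<^sup>2 = (\<Sum>\<^sub>\<infinity>x. if x \<in> F then 0 else ?f x)"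
      unfolding norm_power2_ell2 
      by (rule infsum_cong) (use that in \<open>simp add: minus_ell2.rep_eq trunc_def coord_sum_delta\<close>)
    also have "\<dots> = infsum ?f (UNIV - F)"
      by (rule infsum_cong_neutral) auto
    also have "\<dots> = infsum ?f UNIV - sum ?f F"
      using that S by (subst infsum_Diff) auto
    finally show ?thesis .
  qed
  have "(sum ?f \<longlongrightarrow> infsum ?f UNIV) (finite_subsets_at_top UNIV)"
    using S by (rule infsum_tendsto)
  then have "((\<lambda>F. infsum ?f UNIV - sum ?f F) \<longlongrightarrow> infsum ?f UNIV - infsum ?f UNIV) (finite_subsets_at_top UNIV)"
    by (intro tendsto_intros)
  then have "((\<lambda>F. (norm (trunc F u - u))\<^sup>2) \<longlongrightarrow> 0) (finite_subsets_at_top UNIV)"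
    by (subst tendsto_cong[where g = "\<lambda>F. infsum ?f UNIV - sum ?f F"])
      (auto intro!: eventually_finite_subsets_at_top_weakI eq)
  then have "((\<lambda>F. sqrt ((norm (trunc F u - u))\<^sup>2)) \<longlongrightarrow> sqrt 0) (finite_subsets_at_top UNIV)"
    by (rule tendsto_real_sqrt)
  then show ?thesis
    by (subst Lim_null) (rule tendsto_norm_zero_cancel, simp)
qed

lemma cinner_sum_left: "cinner (\<Sum>x\<in>F. f x) v = (\<Sum>x\<in>F. cinner (f x) v)"
proof (induction F rule: infinite_finite_induct)
  case (insert x F)
  then show ?case by (simp add: cinner_add_left)
qed (simp_all add: cinner.rep_eq zero_ell2.rep_eq)

lemma adj_exists:
  fixes a :: "'a ell2_op"
  assumes a: "a \<in> bounded_ops"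
  obtains b where "b \<in> bounded_ops" "\<And>u v. cinner (blinfun_apply a u) v = cinner u (blinfun_apply b v)"
proof -
  let ?w = "\<lambda>v x. cinner v (blinfun_apply a (delta x))"
  have fin: "cinner (blinfun_apply a (\<Sum>x\<in>F. scaleC_ell2 (c x) (delta x))) v
      = (\<Sum>x\<in>F. c x * cnj (?w v x))" for F c v
    using a by (simp add: bounded_ops_def blinfun.sum_right cinner_sum_left cinner_scaleC_left
        flip: cinner_commute)
  have bound: "(\<Sum>x\<in>F. (cmod (?w v x))\<^sup>2) \<le> (norm a * norm v)\<^sup>2" if "finite F" for F v
  proof -
    define S where "S = (\<Sum>x\<in>F. (cmod (?w v x))\<^sup>2)"
    define u where "u = (\<Sum>x\<in>F. scaleC_ell2 (?w v x) (delta x))"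
    have S0: "S \<ge> 0" by (simp add: S_def sum_nonneg)
    have "(norm u)\<^sup>2 = (\<Sum>\<^sub>\<infinity>x. if x \<in> F then (cmod (?w v x))\<^sup>2 else 0)"
      unfolding norm_power2_ell2 u_def by (rule infsum_cong) (use that in \<open>simp add: coord_sum_delta\<close>)
    also have "\<dots> = infsum (\<lambda>x. (cmod (?w v x))\<^sup>2) F"
      by (rule infsum_cong_neutral) auto
    finally have nu: "(norm u)\<^sup>2 = S" using that by (simp add: S_def)
    have "cinner (blinfun_apply a u) v = of_real S"
      unfolding u_def fin S_def of_real_sum
      by (intro sum.cong refl) (simp only: complex_norm_square)
    then have "S = cmod (cinner (blinfun_apply a u) v)" using S0 by simp
    also have "\<dots> \<le> norm (blinfun_apply a u) * norm v" by (rule cinner_bound)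
    also have "\<dots> \<le> (norm a * norm u) * norm v" by (intro mult_right_mono norm_blinfun) simp
    finally have "norm u * norm u \<le> norm u * (norm a * norm v)"
      using nu by (simp add: power2_eq_square mult_ac)
    then have "norm u \<le> norm a * norm v"
      by (cases "norm u = 0") (auto simp: mult_le_cancel_left)
    then show ?thesis using nu unfolding S_def[symmetric]
      by (metis norm_ge_zero power_mono)
  qed
  have summ: "(\<lambda>x. (cmod (?w v x))\<^sup>2) summable_on UNIV" for v
    by (rule nonneg_bdd_above_summable_on) (use bound[of _ v] in \<open>auto intro!: bdd_aboveI\<close>)
  define b where "b v = Abs_ell2 (?w v)" for v
  have coord_b: "coord (b v) x = ?w v x" for v x
    using summ[of v] unfolding b_def by (simp add: Abs_ell2_inverse)
  have bscale: "b (scaleC_ell2 c v) = scaleC_ell2 c (b v)" for c v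
    by (intro coord_inject[THEN iffD1] ext)
       (simp only: coord_b cinner_scaleC_left scaleC_ell2.rep_eq)
  have "bounded_linear b"
  proof (rule bounded_linear_intro)
    show "b (u + v) = b u + b v" for u v
      by (intro coord_inject[THEN iffD1] ext)
         (simp only: coord_b cinner_add_left plus_ell2.rep_eq)
    show "b (r *\<^sub>R v) = r *\<^sub>R b v" for r v
      by (simp only: scaleR_scaleC_ell2 bscale)
    show "norm (b v) \<le> norm v * norm a" for v
    proof -
      have "(\<Sum>\<^sub>\<infinity>x. (cmod (?w v x))\<^sup>2) \<le> (norm a * norm v)\<^sup>2"
        using summ bound by (rule infsum_le_finite_sums)
      then have "(norm (b v))\<^sup>2 \<le> (norm a * norm v)\<^sup>2"
        by (simp only: norm_power2_ell2 coord_b)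
      then have "norm (b v) \<le> norm a * norm v"
        by (rule power2_le_imp_le) simp
      then show ?thesis by (simp only: mult.commute)
    qed
  qed
  then have app: "blinfun_apply (Blinfun b) = b" by (rule bounded_linear_Blinfun_apply)
  have main: "cinner (blinfun_apply a u) v = cinner u (b v)" for u v
  proof -
    have "((\<lambda>F. cinner (blinfun_apply a (trunc F u)) v) \<longlongrightarrow> cinner (blinfun_apply a u) v) (finite_subsets_at_top UNIV)"
    proof -
      have bl: "bounded_linear (\<lambda>u. cinner u v)"
      proof (rule bounded_linear_intro)
        show "norm (cinner u v) \<le> norm u * norm v" for u by (rule cinner_bound)
      qed (simp_all add: cinner_add_left scaleR_scaleC_ell2 cinner_scaleC_left scaleR_conv_of_real)
      show ?thesis
        by (intro bounded_linear.tendsto[OF bl] blinfun.tendsto trunc_tendsto tendsto_const)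
    qed
    moreover have "((\<lambda>F. \<Sum>x\<in>F. coord u x * cnj (coord (b v) x)) \<longlongrightarrow> cinner u (b v)) (finite_subsets_at_top UNIV)"
      unfolding cinner.rep_eq
      by (rule infsum_tendsto, rule ell2_mult_summable) (use coord[of u] coord[of "b v"] in auto)
    ultimately show ?thesis
      unfolding trunc_def fin coord_b
      by (rule tendsto_unique[rotated]) simp
  qed
  show thesis
  proof (rule that)
    show "Blinfun b \<in> bounded_ops"
      unfolding bounded_ops_def by (rule CollectI) (simp only: app bscale simp_thms)
    show "cinner (blinfun_apply a u) v = cinner u (blinfun_apply (Blinfun b) v)" for u v
      unfolding app by (rule main)
  qed
qed

lemma adj_props:
  assumes "a \<in> bounded_ops"
  shows "adj a \<in> bounded_ops" "cinner (blinfun_apply a u) v = cinner u (blinfun_apply (adj a) v)"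
proof -
  obtain b where b: "b \<in> bounded_ops"
    "\<And>u v. cinner (blinfun_apply a u) v = cinner u (blinfun_apply b v)"
    using adj_exists[OF assms] by blast
  have "adj a = b" using b(2) by (rule adj_eqI)
  with b show "adj a \<in> bounded_ops"
    "cinner (blinfun_apply a u) v = cinner u (blinfun_apply (adj a) v)" by (simp_all only:)
qed

definition finite_propagation :: "'a::metric_space ell2_op \<Rightarrow> bool"
  where "finite_propagation a \<longleftrightarrow>
    (\<exists>r>0. \<forall>x y. dist x y > r \<longrightarrow> cinner (blinfun_apply a (delta x)) (delta y) = 0)"

definition uniform_roe :: "'a::metric_space ell2_op set"
  where "uniform_roe = closure {a \<in> bounded_ops. finite_propagation a}"

definition uniformly_locally_finite :: "'a::metric_space itself \<Rightarrow> bool"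
  where "uniformly_locally_finite _ \<longleftrightarrow>
    (\<forall>r>0. \<exists>N. \<forall>x::'a. finite (cball x r) \<and> card (cball x r) \<le> N)"

text \<open>Nonempty intersections are required explicitly because of \<open>a / 0 = 0\<close>.\<close>

definition property_A :: "'a::metric_space itself \<Rightarrow> bool"
  where "property_A _ \<longleftrightarrow>
    (\<forall>r>0. \<forall>\<epsilon>>0. \<exists>R>0. \<exists>A :: 'a \<Rightarrow> ('a \<times> nat) set.
      (\<forall>x. finite (A x) \<and> (x, 1) \<in> A x) \<and>
      (\<forall>x y. dist x y \<le> r \<longrightarrow>
        A x \<inter> A y \<noteq> {} \<and>
        real (card ((A x - A y) \<union> (A y - A x))) / real (card (A x \<inter> A y)) < \<epsilon>) \<and>
      (\<forall>x y z m n. (y, m) \<in> A x \<and> (z, n) \<in> A x \<longrightarrow> dist y z \<le> R))"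

definition compact_op :: "'a ell2_op \<Rightarrow> bool"
  where "compact_op a \<longleftrightarrow> compact (closure (blinfun_apply a ` cball 0 1))"

definition star_hom :: "'a ell2_op set \<Rightarrow> 'b ell2_op set \<Rightarrow> ('a ell2_op \<Rightarrow> 'b ell2_op) \<Rightarrow> bool"
  where "star_hom A B \<Phi> \<longleftrightarrow>
    \<Phi> ` A \<subseteq> B \<and>
    (\<forall>a\<in>A. \<forall>b\<in>A. \<Phi> (a + b) = \<Phi> a + \<Phi> b) \<and>
    (\<forall>c. \<forall>a\<in>A. \<Phi> (scaleC_op c a) = scaleC_op c (\<Phi> a)) \<and>
    (\<forall>a\<in>A. \<forall>b\<in>A. \<Phi> (a o\<^sub>L b) = \<Phi> a o\<^sub>L \<Phi> b) \<and>
    (\<forall>a\<in>A. \<Phi> (adj a) = adj (\<Phi> a))"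

definition roe_embedding :: "('a::metric_space ell2_op \<Rightarrow> 'b::metric_space ell2_op) \<Rightarrow> bool"
  where "roe_embedding \<Phi> \<longleftrightarrow> star_hom uniform_roe uniform_roe \<Phi> \<and> inj_on \<Phi> uniform_roe"

definition compact_preserving :: "('a::metric_space ell2_op \<Rightarrow> 'b::metric_space ell2_op) \<Rightarrow> bool"
  where "compact_preserving \<Phi> \<longleftrightarrow> (\<forall>a\<in>uniform_roe. compact_op a \<longrightarrow> compact_op (\<Phi> a))"

definition strongly_continuous :: "('a::metric_space ell2_op \<Rightarrow> 'b::metric_space ell2_op) \<Rightarrow> bool"
  where "strongly_continuous \<Psi> \<longleftrightarrow>
    (\<forall>a l. (\<forall>k::nat. a k \<in> uniform_roe) \<and> l \<in> uniform_roe \<and>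
      limitin strong_operator_topology a l sequentially \<longrightarrow>
      limitin strong_operator_topology (\<lambda>k. \<Psi> (a k)) (\<Psi> l) sequentially)"

definition projection :: "'a ell2_op \<Rightarrow> bool"
  where "projection p \<longleftrightarrow> p \<in> bounded_ops \<and> p o\<^sub>L p = p \<and> adj p = p"

end

theory Submission
  imports Defs "HOL-Complex_Analysis.Great_Picard"
begin

text \<open>
  For finite \<open>F \<subseteq> X\<close> let \<open>\<chi>\<^sub>F\<close> be the coordinate projection onto \<open>F\<close>. The projections
  \<open>\<Phi> \<chi>\<^sub>F\<close> increase with \<open>F\<close>, and \<open>p\<close> is their strong limit. An operator of propagation at
  most \<open>r\<close> maps vectors supported in a ball to vectors supported in the concentric ball whose
  radius is larger by \<open>r\<close>, and so does its adjoint; hence \<open>p\<close> commutes with the image of \<open>\<Phi>\<close>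
  (\<open>commute_with_limit\<close>). On the range of \<open>p\<close> strong continuity reduces to vectors in the range
  of a single \<open>\<Phi> \<chi>\<^sub>F\<close>, where it holds because strong convergence of \<open>a\<^sub>k\<close> gives norm
  convergence of \<open>a\<^sub>k \<chi>\<^sub>F\<close>, and \<open>\<Phi>\<close> is
  contractive (\<open>hom_norm_le\<close>). Strongly convergent sequences are bounded
  (\<open>uniform_boundedness\<close>), which extends the convergence to the closure. The cut-down map is
  nonzero because \<open>\<Phi>\<close> is injective.

  The substance of the theorem is that \<open>p\<close> belongs to the uniform Roe algebra of \<open>Y\<close>. The key
  point is that for every \<open>\<epsilon> > 0\<close> there is one \<open>r\<close> such that all \<open>\<Phi> \<chi>\<^sub>F\<close>, \<open>F\<close> finite, are
  within \<open>\<epsilon>\<close> of operators of propagation at most \<open>r\<close> (\<open>hom_chi_uniformly_banded\<close>).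
  Suppose not. Then there are an \<open>\<epsilon> > 0\<close> and finite sets \<open>F\<^sub>n\<close> such that \<open>\<Phi> \<chi>\<^bsub>F\<^sub>n\<^esub>\<close> has distance more
  than \<open>\<epsilon>\<close> from the space \<open>B\<^sub>n\<close> of operators of propagation at most \<open>n\<close>, and the Hahn-Banach theorem
  gives functionals \<open>f\<^sub>n\<close> of norm at most one that vanish on \<open>B\<^sub>n\<close> with \<open>f\<^sub>n (\<Phi> \<chi>\<^bsub>F\<^sub>n\<^esub>) > \<epsilon>\<close>. For
  every set \<open>A \<subseteq> X\<close>, finite or not, \<open>\<Phi> \<chi>\<^sub>A\<close> is a norm limit of operators of finite propagation,
  so \<open>f\<^sub>n (\<Phi> \<chi>\<^sub>A)\<close> tends to \<open>0\<close>. Thus the finitely additive measures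
  \<open>A \<mapsto> f\<^sub>n (\<Phi> \<chi>\<^sub>A)\<close> converge to \<open>0\<close> setwise, and the lemma of Phillips says that they then
  converge to \<open>0\<close> along every sequence of finite sets (\<open>phillips\<close>), a contradiction.

  It remains to pass to the limit in \<open>F\<close>. A norm-bounded sequence of operators of propagation
  at most \<open>r\<close> has a subsequence that converges weakly to such an operator (\<open>banded_compact\<close>),
  and distances in norm are weakly lower semicontinuous, so \<open>p\<close> is itself within \<open>\<epsilon>\<close> of an operator
  of propagation at most \<open>r\<close> (\<open>roe_if_uniformly_banded\<close>).
\<close>

section \<open>Minimal sublinear functionals and the Hahn-Banach theorem\<close>

definition sublinear :: "('e::real_vector \<Rightarrow> real) \<Rightarrow> bool"
  where "sublinear p \<longleftrightarrow> (\<forall>x y. p (x + y) \<le> p x + p y) \<and> (\<forall>t\<ge>0. \<forall>x. p (t *\<^sub>R x) \<le> t * p x)"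

lemma sublinear_add: "sublinear p \<Longrightarrow> p (x + y) \<le> p x + p y"
  by (simp add: sublinear_def)

lemma sublinear_zero: "sublinear p \<Longrightarrow> p 0 = 0"
  using sublinear_add[of p 0 0] by (auto simp: sublinear_def dest: spec[of _ 0])

lemma sublinear_scale:
  assumes "sublinear p" "t \<ge> 0"
  shows "p (t *\<^sub>R x) = t * p x"
proof (cases "t = 0")
  case False
  with assms have "t > 0" by simp
  have "p ((1 / t) *\<^sub>R (t *\<^sub>R x)) \<le> (1 / t) * p (t *\<^sub>R x)"
    using assms unfolding sublinear_def by (metis divide_nonneg_nonneg zero_le_one)
  then have "t * p x \<le> p (t *\<^sub>R x)"
    using \<open>t > 0\<close> by (simp add: field_simps)
  moreover have "p (t *\<^sub>R x) \<le> t * p x"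
    using assms by (simp add: sublinear_def)
  ultimately show ?thesis by simp
qed (use assms sublinear_zero in simp)

lemma sublinear_minus: "sublinear p \<Longrightarrow> - p (- x) \<le> p x"
  using sublinear_add[of p x "- x"] sublinear_zero[of p] by simp

text \<open>The largest sublinear functional below \<open>p\<close> whose value at \<open>- y\<close> is at most \<open>- p y\<close>: a
  linear functional below it is forced to agree with \<open>p\<close> at \<open>y\<close>.\<close>

definition tilt :: "('e::real_vector \<Rightarrow> real) \<Rightarrow> 'e \<Rightarrow> 'e \<Rightarrow> real"
  where "tilt p y x = (INF t\<in>{0..}. p (x + t *\<^sub>R y) - t * p y)"

lemma tilt_lower:
  assumes "sublinear p" "t \<ge> 0"
  shows "- p (- x) \<le> p (x + t *\<^sub>R y) - t * p y"
  using sublinear_add[OF assms(1), of "x + t *\<^sub>R y" "- x"] sublinear_scale[OF assms, of y] by simp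

lemma tilt_le:
  assumes "sublinear p" "t \<ge> 0"
  shows "tilt p y x \<le> p (x + t *\<^sub>R y) - t * p y"
  unfolding tilt_def
  by (rule cINF_lower) (use assms tilt_lower[OF assms(1)] in \<open>auto intro!: bdd_belowI2\<close>)

lemma sublinear_tilt:
  assumes "sublinear p"
  shows "sublinear (tilt p y)"
  unfolding sublinear_def
proof (intro conjI allI impI)
  fix x x'
  have 1: "tilt p y (x + x') \<le> (p (x + t *\<^sub>R y) - t * p y) + (p (x' + s *\<^sub>R y) - s * p y)"
    if "t \<ge> 0" "s \<ge> 0" for t s
    using tilt_le[OF assms, of "t + s" y "x + x'"] that
      sublinear_add[OF assms, of "x + t *\<^sub>R y" "x' + s *\<^sub>R y"]
    by (simp add: algebra_simps)
  have "tilt p y (x + x') - (p (x + t *\<^sub>R y) - t * p y) \<le> tilt p y x'" if "t \<ge> 0" for t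
    unfolding tilt_def[of p y x']
    by (rule cINF_greatest) (use 1[OF that] in \<open>auto simp: algebra_simps\<close>)
  then have "tilt p y (x + x') - tilt p y x' \<le> tilt p y x"
    unfolding tilt_def[of p y x] by (intro cINF_greatest) (auto simp: algebra_simps)
  then show "tilt p y (x + x') \<le> tilt p y x + tilt p y x'" by simp
next
  fix t :: real and x
  assume "t \<ge> 0"
  show "tilt p y (t *\<^sub>R x) \<le> t * tilt p y x"
  proof (cases "t = 0")
    case True
    then show ?thesis using tilt_le[OF assms, of 0 y 0] sublinear_zero[OF assms] by simp
  next
    case False
    with \<open>t \<ge> 0\<close> have "t > 0" by simp
    have "tilt p y (t *\<^sub>R x) / t \<le> p (x + s *\<^sub>R y) - s * p y" if "s \<ge> 0" for s
    proof -
      have "tilt p y (t *\<^sub>R x) \<le> p (t *\<^sub>R (x + s *\<^sub>R y)) - (t * s) * p y"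
        using tilt_le[OF assms, of "t * s" y "t *\<^sub>R x"] that \<open>t > 0\<close> by (simp add: algebra_simps)
      also have "\<dots> = t * (p (x + s *\<^sub>R y) - s * p y)"
        using sublinear_scale[OF assms, of t "x + s *\<^sub>R y"] \<open>t > 0\<close> by (simp add: algebra_simps)
      finally show ?thesis using \<open>t > 0\<close> by (simp add: field_simps)
    qed
    then have "tilt p y (t *\<^sub>R x) / t \<le> tilt p y x"
      unfolding tilt_def[of p y x] by (intro cINF_greatest) auto
    then show ?thesis using \<open>t > 0\<close> by (simp add: field_simps)
  qed
qed

text \<open>Tilting a minimal functional cannot decrease it, and comparing with the tilted value
  at \<open>t = 1\<close> gives superadditivity.\<close>

lemma linear_if_minimal_sublinear:
  assumes m: "sublinear m" and min: "\<And>p. sublinear p \<Longrightarrow> p \<le> m \<Longrightarrow> p = m"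
  shows "linear m"
proof -
  have "tilt m y = m" for y
    using tilt_le[OF m, of 0 y] by (intro min sublinear_tilt m) (simp add: le_fun_def)
  then have "m x + m y \<le> m (x + y)" for x y
    using tilt_le[OF m, of 1 y x] by simp
  then have add: "m (x + y) = m x + m y" for x y
    using sublinear_add[OF m] by (simp add: order.antisym)
  then have neg: "m (- x) = - m x" for x
    using add[of x "- x"] sublinear_zero[OF m] by simp
  have "m (t *\<^sub>R x) = t * m x" for t x
  proof (cases "t \<ge> 0")
    case False
    then show ?thesis using sublinear_scale[OF m, of "- t" x] neg[of "t *\<^sub>R x"] by simp
  qed (rule sublinear_scale[OF m])
  with add show ?thesis by (intro linearI) simp_all
qed

text \<open>Zorn's lemma applies because a chain of sublinear functionals below \<open>q\<close> is bounded below
  pointwise by \<open>- q (- x)\<close>, so that its pointwise infimum exists.\<close>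

lemma ex_minimal_sublinear:
  assumes q: "sublinear q"
  obtains m where "sublinear m" "m \<le> q" "\<And>p. sublinear p \<Longrightarrow> p \<le> m \<Longrightarrow> p = m"
proof -
  let ?A = "{p. sublinear p \<and> p \<le> q}"
  let ?P = "\<lambda>a b :: 'a \<Rightarrow> real. b \<le> a"
  have "\<exists>m\<in>?A. \<forall>a\<in>?A. ?P m a \<longrightarrow> a = m"
  proof (rule predicate_Zorn)
    show "partial_order_on ?A (relation_of ?P ?A)"
      by (rule partial_order_on_relation_ofI) auto
  next
    fix C assume C: "C \<in> Chains (relation_of ?P ?A)"
    then have CA: "C \<subseteq> ?A" and tot: "\<And>a b. a \<in> C \<Longrightarrow> b \<in> C \<Longrightarrow> a \<le> b \<or> b \<le> a"
      unfolding Chains_def relation_of_def by auto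
    show "\<exists>u\<in>?A. \<forall>a\<in>C. ?P a u"
    proof (cases "C = {}")
      case True
      then show ?thesis using q by auto
    next
      case False
      define u where "u x = (INF p\<in>C. p x)" for x
      have low: "- q (- x) \<le> p x" if "p \<in> C" for p x
        using sublinear_minus[of p x] that CA le_funD[of p q "- x"] by force
      have ule: "u x \<le> p x" if "p \<in> C" for p x
        unfolding u_def by (rule cINF_lower) (use low that in \<open>auto intro!: bdd_belowI2\<close>)
      have "sublinear u"
        unfolding sublinear_def
      proof (intro conjI allI impI)
        fix x y
        \<comment> \<open>Of two members of the chain the smaller one bounds both summands.\<close>
        have "u (x + y) \<le> p x + p' y" if pp: "p \<in> C" "p' \<in> C" for p p'
        proof -
          obtain r where r: "r \<in> C" "r \<le> p" "r \<le> p'" using tot[OF pp] pp by blast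
          then have "u (x + y) \<le> r x + r y"
            using ule[of r "x + y"] sublinear_add[of r x y] CA by fastforce
          then show ?thesis using le_funD[OF r(2), of x] le_funD[OF r(3), of y] by simp
        qed
        then have "u (x + y) - p x \<le> p' y" if "p \<in> C" "p' \<in> C" for p p'
          using that by (simp add: diff_le_eq add.commute[of "p' y"])
        then have "u (x + y) - p x \<le> u y" if "p \<in> C" for p
          unfolding u_def[of y] by (intro cINF_greatest) (use that False in auto)
        then have "u (x + y) - u y \<le> u x"
          unfolding u_def[of x] by (intro cINF_greatest) (use False in \<open>auto simp: algebra_simps\<close>)
        then show "u (x + y) \<le> u x + u y" by simp
      next
        fix t :: real and x
        assume t: "t \<ge> 0"
        have "u (t *\<^sub>R x) \<le> t * p x" if "p \<in> C" for p
          using ule[OF that, of "t *\<^sub>R x"] sublinear_scale[of p t x] CA that t by auto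
        then show "u (t *\<^sub>R x) \<le> t * u x"
        proof (cases "t = 0")
          case True
          then show ?thesis using \<open>\<And>p. p \<in> C \<Longrightarrow> u (t *\<^sub>R x) \<le> t * p x\<close> False by auto
        next
          case nz: False
          with t have "t > 0" by simp
          with \<open>\<And>p. p \<in> C \<Longrightarrow> u (t *\<^sub>R x) \<le> t * p x\<close> have "u (t *\<^sub>R x) / t \<le> u x"
            unfolding u_def[of x] by (intro cINF_greatest) (use False in \<open>auto simp: field_simps\<close>)
          then show ?thesis using \<open>t > 0\<close> by (simp add: field_simps)
        qed
      qed
      moreover have "u \<le> q"
      proof -
        from False obtain p where "p \<in> C" by auto
        then show ?thesis using ule CA by (force simp: le_fun_def intro: order.trans)
      qed
      ultimately show ?thesis using ule by (auto simp: le_fun_def)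
    qed
  qed
  then obtain m where "sublinear m" "m \<le> q" "\<And>p. sublinear p \<Longrightarrow> p \<le> q \<Longrightarrow> p \<le> m \<Longrightarrow> p = m"
    by blast
  then show thesis by (intro that) (auto intro: order.trans)
qed

text \<open>A minimal functional below the tilt of \<open>q\<close> in the direction \<open>x0\<close> is linear and attains
  \<open>q x0\<close>.\<close>

proposition hahn_banach_sublinear:
  assumes "sublinear q"
  obtains f where "linear f" "\<And>x. f x \<le> q x" "f x0 = q x0"
proof -
  obtain m where m: "sublinear m" "m \<le> tilt q x0" "\<And>p. sublinear p \<Longrightarrow> p \<le> m \<Longrightarrow> p = m"
    using ex_minimal_sublinear[OF sublinear_tilt[OF assms]] by blast
  have lin: "linear m" using m(1,3) by (rule linear_if_minimal_sublinear)
  have le: "m x \<le> q x" for x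
    using le_funD[OF m(2), of x] tilt_le[OF assms, of 0 x0 x] by simp
  have "m (- x0) \<le> - q x0"
    using le_funD[OF m(2), of "- x0"] tilt_le[OF assms, of 1 x0 "- x0"] sublinear_zero[OF assms] by simp
  then have "m x0 = q x0"
    using le[of x0] linear_neg[OF lin, of x0] by simp
  with lin le that show thesis by blast
qed

lemma sublinear_infdist_subspace:
  fixes S :: "'e::real_normed_vector set"
  assumes S: "subspace S"
  shows "sublinear (\<lambda>x. infdist x S)"
  unfolding sublinear_def
proof (intro conjI allI impI)
  have ne: "S \<noteq> {}" using subspace_0[OF S] by auto
  have inf: "infdist x S = (INF a\<in>S. dist x a)" for x using ne by (simp add: infdist_def)
  fix x y :: 'e
  have "infdist (x + y) S \<le> dist x a + dist y b" if "a \<in> S" "b \<in> S" for a b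
    using infdist_le[OF subspace_add[OF S that], of "x + y"] dist_triangle_add[of x y a b] by simp
  then have "infdist (x + y) S - dist x a \<le> infdist y S" if "a \<in> S" for a
    unfolding inf[of y] by (intro cINF_greatest ne) (use that in \<open>auto simp: algebra_simps\<close>)
  then have "infdist (x + y) S - infdist y S \<le> infdist x S"
    unfolding inf[of x] by (intro cINF_greatest ne) (auto simp: algebra_simps)
  then show "infdist (x + y) S \<le> infdist x S + infdist y S" by simp
next
  have ne: "S \<noteq> {}" using subspace_0[OF S] by auto
  fix t :: real and x :: 'e assume t: "t \<ge> 0"
  show "infdist (t *\<^sub>R x) S \<le> t * infdist x S"
  proof (cases "t = 0")
    case True
    then show ?thesis using subspace_0[OF S] by simp
  next
    case False
    with t have "t > 0" by simp
    have "infdist (t *\<^sub>R x) S \<le> t * dist x a" if "a \<in> S" for a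
      using infdist_le[OF subspace_scale[OF S that], of "t *\<^sub>R x" t] t by (simp add: dist_norm flip: scaleR_diff_right)
    then have "infdist (t *\<^sub>R x) S / t \<le> infdist x S"
      unfolding infdist_notempty[OF ne, of x]
      by (intro cINF_greatest ne) (use \<open>t > 0\<close> in \<open>auto simp: field_simps\<close>)
    then show ?thesis using \<open>t > 0\<close> by (simp add: field_simps)
  qed
qed

text \<open>A functional of norm at most one that vanishes on \<open>S\<close> and attains the distance of \<open>x\<close>
  from \<open>S\<close>; the bound by the distance expresses both properties at once.\<close>

proposition hahn_banach_infdist:
  fixes S :: "'e::real_normed_vector set"
  assumes S: "subspace S"
  obtains f where "linear f" "\<And>y. \<bar>f y\<bar> \<le> infdist y S" "f x = infdist x S"
proof -
  obtain f where f: "linear f" "\<And>y. f y \<le> infdist y S" "f x = infdist x S"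
    using hahn_banach_sublinear[OF sublinear_infdist_subspace[OF S]] by blast
  have "infdist (- y) S = infdist y S" for y
  proof -
    have "infdist (- z) S \<le> infdist z S" for z
      unfolding infdist_def
    proof (simp, intro impI cINF_mono)
      fix a assume "a \<in> S"
      then show "\<exists>b\<in>S. dist (- z) b \<le> dist z a"
        by (intro bexI[of _ "- a"]) (auto simp: subspace_neg[OF S] dist_minus)
    qed (auto intro!: bdd_belowI2[where m = 0])
    from this[of y] this[of "- y"] show ?thesis by simp
  qed
  then have "\<bar>f y\<bar> \<le> infdist y S" for y
    using f(2)[of y] f(2)[of "- y"] linear_neg[OF f(1), of y] by simp
  with f that show thesis by blast
qed

section \<open>Phillips' lemma and uniform approximation on finite sets\<close>

definition fin_additive :: "('x set \<Rightarrow> real) \<Rightarrow> bool"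
  where "fin_additive \<nu> \<longleftrightarrow> (\<forall>A B. A \<inter> B = {} \<longrightarrow> \<nu> (A \<union> B) = \<nu> A + \<nu> B)"

lemma fin_additiveD: "fin_additive \<nu> \<Longrightarrow> A \<inter> B = {} \<Longrightarrow> \<nu> (A \<union> B) = \<nu> A + \<nu> B"
  by (simp add: fin_additive_def)

lemma fin_additive_UN:
  assumes "fin_additive \<nu>" "finite I" "disjoint_family_on B I"
  shows "\<nu> (\<Union>i\<in>I. B i) = (\<Sum>i\<in>I. \<nu> (B i))"
  using assms(2,3)
proof (induction I rule: finite_induct)
  case empty
  then show ?case using fin_additiveD[OF assms(1), of "{}" "{}"] by simp
next
  case (insert i I)
  have "B i \<inter> (\<Union>j\<in>I. B j) = {}"
    using insert by (force simp: disjoint_family_on_def)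
  moreover have "disjoint_family_on B I"
    using insert.prems by (auto simp: disjoint_family_on_def)
  ultimately show ?case using insert fin_additiveD[OF assms(1)] by simp
qed

text \<open>Finitely additive measures with bounded values have bounded variation: the indices with
  nonnegative and with negative values contribute at most \<open>C\<close> each.\<close>

lemma fin_additive_variation:
  assumes \<nu>: "fin_additive \<nu>" and C: "\<And>A. \<bar>\<nu> A\<bar> \<le> C"
    and I: "finite I" "disjoint_family_on B I"
  shows "(\<Sum>i\<in>I. \<bar>\<nu> (B i)\<bar>) \<le> 2 * C"
proof -
  let ?P = "{i\<in>I. \<nu> (B i) \<ge> 0}" and ?N = "{i\<in>I. \<not> \<nu> (B i) \<ge> 0}"
  have "(\<Sum>i\<in>I. \<bar>\<nu> (B i)\<bar>) = (\<Sum>i\<in>?P. \<bar>\<nu> (B i)\<bar>) + (\<Sum>i\<in>?N. \<bar>\<nu> (B i)\<bar>)"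
    using I(1) by (subst sum.union_disjoint[symmetric]) (auto intro!: sum.cong)
  also have "\<dots> = (\<Sum>i\<in>?P. \<nu> (B i)) - (\<Sum>i\<in>?N. \<nu> (B i))"
    by (simp add: sum_negf[symmetric])
  also have "(\<Sum>i\<in>?P. \<nu> (B i)) = \<nu> (\<Union>i\<in>?P. B i)"
    using I by (intro fin_additive_UN[OF \<nu>, symmetric]) (auto simp: disjoint_family_on_def)
  also have "(\<Sum>i\<in>?N. \<nu> (B i)) = \<nu> (\<Union>i\<in>?N. B i)"
    using I by (intro fin_additive_UN[OF \<nu>, symmetric]) (auto simp: disjoint_family_on_def)
  finally show ?thesis using C[of "\<Union>i\<in>?P. B i"] C[of "\<Union>i\<in>?N. B i"] by linarith
qed

text \<open>Split \<open>M\<close> into infinitely many infinite pieces. Were each of them to contain a set of measure more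
  than \<open>\<delta>\<close>, the variation would be infinite.\<close>

lemma ex_infinite_subset_small:
  fixes \<nu> :: "nat set \<Rightarrow> real"
  assumes \<nu>: "fin_additive \<nu>" and C: "\<And>A. \<bar>\<nu> A\<bar> \<le> C" and M: "infinite M" and \<delta>: "\<delta> > 0"
  obtains M' where "infinite M'" "M' \<subseteq> M" "\<And>B. B \<subseteq> M' \<Longrightarrow> \<bar>\<nu> B\<bar> \<le> \<delta>"
proof (rule ccontr)
  assume contra: "\<not> thesis"
  \<comment> \<open>The pieces are the rows of a bijection between pairs of naturals and \<open>M\<close>.\<close>
  define e where "e i j = enumerate M (prod_encode (i, j))" for i j
  have inj: "e i j = e i' j' \<longleftrightarrow> i = i' \<and> j = j'" for i j i' j'
    using M by (auto simp: e_def inj_eq[OF inj_enumerate])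
  have "\<exists>B. B \<subseteq> range (e i) \<and> \<bar>\<nu> B\<bar> > \<delta>" for i
  proof (rule ccontr)
    assume no: "\<not> ?thesis"
    have "infinite (range (e i))"
      by (rule range_inj_infinite) (simp add: inj_def inj)
    moreover have "range (e i) \<subseteq> M"
      using enumerate_in_set[OF M] by (auto simp: e_def)
    moreover have "\<bar>\<nu> B\<bar> \<le> \<delta>" if "B \<subseteq> range (e i)" for B
      using no that by (meson not_le)
    ultimately have thesis by (rule that)
    with contra show False ..
  qed
  then obtain B where B: "\<And>i. B i \<subseteq> range (e i)" "\<And>i. \<bar>\<nu> (B i)\<bar> > \<delta>" by metis
  obtain n :: nat where n: "2 * C < of_nat n * \<delta>"
    using reals_Archimedean3[OF \<delta>] by blast
  have "disjoint_family_on B {..<n}"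
    unfolding disjoint_family_on_def
  proof (intro ballI impI)
    fix i j :: nat assume "i \<noteq> j"
    then have "range (e i) \<inter> range (e j) = {}" using inj by auto
    then show "B i \<inter> B j = {}" using B(1)[of i] B(1)[of j] by blast
  qed
  then have "(\<Sum>i<n. \<bar>\<nu> (B i)\<bar>) \<le> 2 * C"
    by (intro fin_additive_variation[OF \<nu> C]) auto
  moreover have "of_nat n * \<delta> \<le> (\<Sum>i<n. \<bar>\<nu> (B i)\<bar>)"
    using sum_mono[of "{..<n}" "\<lambda>_. \<delta>" "\<lambda>i. \<bar>\<nu> (B i)\<bar>"] B(2) by (auto simp: less_imp_le)
  ultimately show False using n by simp
qed

text \<open>The set \<open>K = {k\<^sub>0 < k\<^sub>1 < \<dots>}\<close> is chosen such that every set of later members of \<open>K\<close> has measure at most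
  \<open>\<delta>\<close> under \<open>\<nu> k\<^sub>i\<close>. Together with the hypothesis on earlier indices, a value of more than
  \<open>3 \<delta>\<close> at the point \<open>k\<^sub>i\<close> would keep \<open>\<nu> k\<^sub>i K\<close> away from \<open>0\<close> for all \<open>i\<close>.\<close>

lemma phillips_gliding_hump:
  fixes \<nu> :: "nat \<Rightarrow> nat set \<Rightarrow> real"
  assumes add: "\<And>k. fin_additive (\<nu> k)" and C: "\<And>k A. \<bar>\<nu> k A\<bar> \<le> C"
    and lim: "\<And>A. (\<lambda>k. \<nu> k A) \<longlonglongrightarrow> 0"
    and early: "\<And>k B. B \<subseteq> {..<k} \<Longrightarrow> \<bar>\<nu> k B\<bar> \<le> \<delta>"
    and \<delta>: "\<delta> > 0"
  shows "\<exists>k. \<bar>\<nu> k {k}\<bar> \<le> 3 * \<delta>"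
proof (rule ccontr)
  assume "\<not> ?thesis"
  then have big: "\<bar>\<nu> k {k}\<bar> > 3 * \<delta>" for k by (simp add: not_le)
  \<comment> \<open>Each stage fixes the next index as the least element of the current infinite set \<open>M\<close>.\<close>
  let ?Q = "\<lambda>M M'. M' \<subseteq> M \<inter> {Inf M<..} \<and> (\<forall>B\<subseteq>M'. \<bar>\<nu> (Inf M) B\<bar> \<le> \<delta>)"
  have "\<exists>M :: nat \<Rightarrow> nat set. \<forall>i. infinite (M i) \<and> ?Q (M i) (M (Suc i))"
  proof (rule dependent_nat_choice)
    show "\<exists>M :: nat set. infinite M" by (rule exI[of _ UNIV]) simp
    fix M :: "nat set" assume M: "infinite M"
    have "M - {..Inf M} = M \<inter> {Inf M<..}" by auto
    then have "infinite (M \<inter> {Inf M<..})"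
      using Diff_infinite_finite[OF finite_atMost M] by metis
    then obtain M' where "infinite M'" "M' \<subseteq> M \<inter> {Inf M<..}"
      "\<And>B. B \<subseteq> M' \<Longrightarrow> \<bar>\<nu> (Inf M) B\<bar> \<le> \<delta>"
      using ex_infinite_subset_small[OF add C _ \<delta>] by metis
    then show "\<exists>M'. infinite M' \<and> ?Q M M'" by blast
  qed
  then obtain M where inf: "\<And>i. infinite (M i)" and Q: "\<And>i. ?Q (M i) (M (Suc i))" by blast
  define k where "k i = Inf (M i)" for i
  have kM: "k i \<in> M i" for i
    unfolding k_def using inf[of i] by (intro Inf_nat_def1) auto
  have dec: "M j \<subseteq> M i" if "i \<le> j" for i j
    using Q by (intro lift_Suc_antimono_le[OF _ that]) blast
  have kk: "k j \<in> M (Suc i)" "k i < k j" if "i < j" for i j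
  proof -
    show "k j \<in> M (Suc i)" using dec[of "Suc i" j] kM[of j] that by auto
    then show "k i < k j" using Q[of i] unfolding k_def by blast
  qed
  then have sm: "strict_mono k" by (simp add: strict_mono_def)
  let ?K = "range k"
  have "\<delta> < \<bar>\<nu> (k i) ?K\<bar>" for i
  proof -
    have "(UNIV :: nat set) = ({..<i} \<union> {i}) \<union> {i<..}" by auto
    then have split: "?K = (k ` {..<i} \<union> {k i}) \<union> k ` {i<..}"
      by (metis image_Un image_empty image_insert)
    have disj: "(k ` {..<i} \<union> {k i}) \<inter> k ` {i<..} = {}" "k ` {..<i} \<inter> {k i} = {}"
      using kk(2) by (auto simp: strict_mono_eq[OF sm])
    have "\<nu> (k i) ?K = \<nu> (k i) (k ` {..<i}) + \<nu> (k i) {k i} + \<nu> (k i) (k ` {i<..})"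
      unfolding split by (simp only: fin_additiveD[OF add disj(1)] fin_additiveD[OF add disj(2)])
    moreover have "\<bar>\<nu> (k i) (k ` {..<i})\<bar> \<le> \<delta>"
      using kk(2) by (intro early) auto
    moreover have "\<bar>\<nu> (k i) (k ` {i<..})\<bar> \<le> \<delta>"
    proof -
      have "k ` {i<..} \<subseteq> M (Suc i)" using kk(1) by auto
      then show ?thesis using Q[of i] unfolding k_def[of i, symmetric] by blast
    qed
    ultimately show ?thesis using big[of "k i"] by linarith
  qed
  moreover have "(\<lambda>i. \<nu> (k i) ?K) \<longlonglongrightarrow> 0"
    using LIMSEQ_subseq_LIMSEQ[OF lim sm, of ?K] by (simp add: o_def)
  ultimately show False
    using \<delta> unfolding LIMSEQ_iff by (metis diff_zero less_asym order_refl real_norm_def)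
qed

text \<open>After passing to a subsequence the finite sets may be replaced by disjoint ones, because a
  finite union of them has only finitely many subsets and the measures tend to \<open>0\<close> on each.
  Viewing these disjoint sets as points reduces the claim to measures on the naturals.\<close>

proposition phillips:
  fixes \<kappa> :: "nat \<Rightarrow> 'x set \<Rightarrow> real"
  assumes add: "\<And>n. fin_additive (\<kappa> n)" and C: "\<And>n A. \<bar>\<kappa> n A\<bar> \<le> C"
    and lim: "\<And>A. (\<lambda>n. \<kappa> n A) \<longlonglongrightarrow> 0"
    and F: "\<And>n. finite (F n)"
  shows "(\<lambda>n. \<kappa> n (F n)) \<longlonglongrightarrow> 0"
proof (rule ccontr)
  assume "\<not> ?thesis"
  then obtain \<epsilon> where \<epsilon>: "\<epsilon> > 0" and freq: "\<And>N. \<exists>n\<ge>N. \<bar>\<kappa> n (F n)\<bar> \<ge> \<epsilon>"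
    unfolding LIMSEQ_iff by (auto simp: not_less)
  \<comment> \<open>Removing the earlier sets costs \<open>\<delta>\<close> and the hump carries \<open>3 \<delta>\<close>; their sum is below \<open>5 \<delta>\<close>.\<close>
  define \<delta> where "\<delta> = \<epsilon> / 5"
  have \<delta>: "\<delta> > 0" using \<epsilon> by (simp add: \<delta>_def)
  let ?G = "\<lambda>n. \<Union>i\<le>n. F i"
  \<comment> \<open>Controlling all sets up to index \<open>n\<close> lets the recursion depend on the last index only.\<close>
  let ?Q = "\<lambda>n n'. n < n' \<and> (\<forall>H\<subseteq>?G n. \<bar>\<kappa> n' H\<bar> \<le> \<delta>)"
  have "\<exists>n :: nat \<Rightarrow> nat. \<forall>k. \<bar>\<kappa> (n k) (F (n k))\<bar> \<ge> \<epsilon> \<and> ?Q (n k) (n (Suc k))"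
  proof (rule dependent_nat_choice)
    show "\<exists>n. \<bar>\<kappa> n (F n)\<bar> \<ge> \<epsilon>" using freq[of 0] by blast
    fix n assume "\<bar>\<kappa> n (F n)\<bar> \<ge> \<epsilon>"
    have "\<forall>H\<in>Pow (?G n). \<forall>\<^sub>F n' in sequentially. \<bar>\<kappa> n' H\<bar> < \<delta>"
      using order_tendstoD(2)[OF tendsto_rabs_zero[OF lim] \<delta>] by blast
    then have "\<forall>\<^sub>F n' in sequentially. \<forall>H\<in>Pow (?G n). \<bar>\<kappa> n' H\<bar> < \<delta>"
      using F by (subst eventually_ball_finite_distrib) auto
    then obtain N where N: "\<And>n' H. n' \<ge> N \<Longrightarrow> H \<subseteq> ?G n \<Longrightarrow> \<bar>\<kappa> n' H\<bar> < \<delta>"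
      by (auto simp: eventually_sequentially)
    obtain n' where "n' \<ge> max N (Suc n)" "\<bar>\<kappa> n' (F n')\<bar> \<ge> \<epsilon>" using freq by blast
    with N show "\<exists>n'. \<bar>\<kappa> n' (F n')\<bar> \<ge> \<epsilon> \<and> ?Q n n'"
      by (intro exI[of _ n']) (force intro: less_imp_le)
  qed
  then obtain n where big: "\<And>k. \<bar>\<kappa> (n k) (F (n k))\<bar> \<ge> \<epsilon>" and Q: "\<And>k. ?Q (n k) (n (Suc k))" by blast
  have sm: "strict_mono n" using Q by (simp add: strict_mono_Suc_iff)
  define D where "D k = F (n k) - (\<Union>j<k. F (n j))" for k
  have disj: "D i \<inter> D j = {}" if "i \<noteq> j" for i j
    using that by (cases i j rule: linorder_cases) (auto simp: D_def)
  have small: "\<bar>\<kappa> (n k) H\<bar> \<le> \<delta>" if "H \<subseteq> (\<Union>j<k. F (n j))" for k H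
  proof (cases k)
    case 0
    then show ?thesis using that \<delta> fin_additiveD[OF add, of "{}" "{}"] by simp
  next
    case (Suc k')
    have "F (n j) \<subseteq> ?G (n k')" if "j < k" for j
    proof -
      have "n j \<le> n k'" using strict_mono_leD[OF sm] that Suc by simp
      then show ?thesis by blast
    qed
    then have "(\<Union>j<k. F (n j)) \<subseteq> ?G (n k')" by (intro UN_least) simp
    with that have "H \<subseteq> ?G (n k')" by (rule order.trans)
    then show ?thesis using Q[of k'] Suc by simp
  qed
  define \<nu> where "\<nu> k B = \<kappa> (n k) (\<Union>j\<in>B. D j)" for k B
  have "\<exists>k. \<bar>\<nu> k {k}\<bar> \<le> 3 * \<delta>"
  proof (rule phillips_gliding_hump[OF _ _ _ _ \<delta>])
    show "fin_additive (\<nu> k)" for k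
      unfolding fin_additive_def
    proof (intro allI impI)
      fix A B :: "nat set" assume "A \<inter> B = {}"
      then have "D i \<inter> D j = {}" if "i \<in> A" "j \<in> B" for i j
        using that by (intro disj) auto
      then have "(\<Union>j\<in>A. D j) \<inter> (\<Union>j\<in>B. D j) = {}" by (simp add: UN_extend_simps)
      then show "\<nu> k (A \<union> B) = \<nu> k A + \<nu> k B"
        unfolding \<nu>_def UN_Un by (rule fin_additiveD[OF add])
    qed
    show "\<bar>\<nu> k A\<bar> \<le> C" for k A unfolding \<nu>_def by (rule C)
    show "(\<lambda>k. \<nu> k A) \<longlonglongrightarrow> 0" for A
      using LIMSEQ_subseq_LIMSEQ[OF lim sm, of "\<Union>j\<in>A. D j"] by (simp add: \<nu>_def o_def)
    show "\<bar>\<nu> k B\<bar> \<le> \<delta>" if "B \<subseteq> {..<k}" for k B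
      unfolding \<nu>_def by (rule small) (use that in \<open>auto simp: D_def\<close>)
  qed
  then obtain k where k: "\<bar>\<nu> k {k}\<bar> \<le> 3 * \<delta>" by blast
  have "F (n k) = D k \<union> (F (n k) \<inter> (\<Union>j<k. F (n j)))" by (auto simp: D_def)
  moreover have "\<kappa> (n k) (D k \<union> (F (n k) \<inter> (\<Union>j<k. F (n j))))
      = \<kappa> (n k) (D k) + \<kappa> (n k) (F (n k) \<inter> (\<Union>j<k. F (n j)))"
    by (rule fin_additiveD[OF add]) (auto simp: D_def)
  moreover have "\<bar>\<kappa> (n k) (F (n k) \<inter> (\<Union>j<k. F (n j)))\<bar> \<le> \<delta>" by (rule small) auto
  ultimately show False using k big[of k] \<delta> by (simp add: \<nu>_def \<delta>_def)
qed

text \<open>Although every \<open>\<mu> A\<close> is approximated by the subspaces \<open>S n\<close>, the speed may depend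
  on \<open>A\<close>. For finite sets it does not: functionals that detect the
  distance from \<open>S n\<close> turn \<open>\<mu>\<close> into scalar measures to which the lemma of Phillips applies.\<close>

proposition uniform_approximation_on_finite_sets:
  fixes \<mu> :: "'x set \<Rightarrow> 'e::real_normed_vector" and S :: "nat \<Rightarrow> 'e set"
  assumes add: "\<And>A B. A \<inter> B = {} \<Longrightarrow> \<mu> (A \<union> B) = \<mu> A + \<mu> B"
    and C: "\<And>A. norm (\<mu> A) \<le> C"
    and S: "\<And>n. subspace (S n)" "incseq S"
    and cl: "\<And>A. \<mu> A \<in> closure (\<Union>n. S n)"
    and \<epsilon>: "\<epsilon> > 0"
  shows "\<exists>n. \<forall>F. finite F \<longrightarrow> infdist (\<mu> F) (S n) \<le> \<epsilon>"
proof (rule ccontr)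
  assume "\<not> ?thesis"
  then obtain F where F: "\<And>n. finite (F n)" "\<And>n. infdist (\<mu> (F n)) (S n) > \<epsilon>"
    by (metis not_le)
  have "\<exists>f. linear f \<and> (\<forall>y. \<bar>f y\<bar> \<le> infdist y (S n)) \<and> f (\<mu> (F n)) = infdist (\<mu> (F n)) (S n)" for n
    using hahn_banach_infdist[OF S(1)] by metis
  then obtain f where f: "\<And>n. linear (f n)" "\<And>n y. \<bar>f n y\<bar> \<le> infdist y (S n)"
    "\<And>n. f n (\<mu> (F n)) = infdist (\<mu> (F n)) (S n)" by metis
  have "(\<lambda>n. f n (\<mu> (F n))) \<longlonglongrightarrow> 0"
  proof (rule phillips[where C = C])
    show "fin_additive (\<lambda>A. f n (\<mu> A))" for n
      by (simp add: fin_additive_def add linear_add[OF f(1)])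
    show "\<bar>f n (\<mu> A)\<bar> \<le> C" for n A
      using f(2)[of n "\<mu> A"] infdist_le[OF subspace_0[OF S(1)], of "\<mu> A" n] C[of A] by simp
    show "(\<lambda>n. f n (\<mu> A)) \<longlonglongrightarrow> 0" for A
      unfolding LIMSEQ_iff
    proof (intro allI impI)
      fix e :: real assume "e > 0"
      then obtain s N where s: "s \<in> S N" "dist s (\<mu> A) < e"
        using cl[of A] unfolding closure_approachable by blast
      have "norm (f n (\<mu> A) - 0) < e" if "n \<ge> N" for n
      proof -
        have "s \<in> S n" using s(1) incseqD[OF S(2) that] by blast
        then show ?thesis
          using f(2)[of n "\<mu> A"] infdist_le[of s "S n" "\<mu> A"] s(2) by (simp add: dist_commute)
      qed
      then show "\<exists>N. \<forall>n\<ge>N. norm (f n (\<mu> A) - 0) < e" by blast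
    qed
  qed (rule F)
  then have "\<forall>\<^sub>F n in sequentially. f n (\<mu> (F n)) < \<epsilon>"
    using \<epsilon> by (rule order_tendstoD)
  then obtain N where "f N (\<mu> (F N)) < \<epsilon>" by (auto simp: eventually_sequentially)
  then show False using f(3)[of N] F(2)[of N] by simp
qed

section \<open>Uniform boundedness\<close>

text \<open>By the Baire category theorem one of the closed sets on which the sequence is bounded by
  \<open>k\<close> contains a ball.\<close>

proposition uniform_boundedness:
  fixes T :: "nat \<Rightarrow> 'a::banach \<Rightarrow>\<^sub>L 'b::real_normed_vector"
  assumes "\<And>u. bounded (range (\<lambda>n. T n u))"
  obtains K where "\<And>n. norm (T n) \<le> K"
proof -
  define B where "B k = {u. \<forall>n. norm (T n u) \<le> real k}" for k
  have closed: "closed (B k)" for k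
    unfolding B_def by (intro closed_Collect_all closed_Collect_le continuous_intros)
  have "(\<Union>k. B k) = UNIV"
  proof -
    have "\<exists>k. u \<in> B k" for u
    proof -
      obtain c where "\<And>n. norm (T n u) \<le> c" using assms[of u] by (auto simp: bounded_iff)
      moreover obtain k where "c \<le> real k" using real_arch_simple by blast
      ultimately have "u \<in> B k" unfolding B_def using order.trans by blast
      then show ?thesis ..
    qed
    then show ?thesis by blast
  qed
  moreover have "euclidean interior_of (\<Union>k. B k) = {}" if "\<And>k. interior (B k) = {}"
    by (rule Baire_category_alt) (use that closed in \<open>auto simp: interior_of_def interior_def completely_metrizable_space_euclidean\<close>)
  ultimately obtain k where "interior (B k) \<noteq> {}" by auto
  then obtain x r where r: "r > 0" "cball x r \<subseteq> B k"
    by (metis all_not_in_conv mem_interior_cball)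
  have "norm (T n) \<le> 2 * real k / r" for n
  proof (rule norm_blinfun_bound)
    show "0 \<le> 2 * real k / r" using r by simp
    fix u :: 'a
    show "norm (T n u) \<le> 2 * real k / r * norm u"
    proof (cases "u = 0")
      case False
      define v where "v = (r / norm u) *\<^sub>R u"
      have "x + v \<in> B k" "x \<in> B k" using r False by (auto simp: v_def dist_norm intro!: subsetD[OF r(2)])
      then have "norm (T n (x + v)) \<le> k" "norm (T n x) \<le> k" by (auto simp: B_def)
      then have "norm (T n v) \<le> 2 * k"
        using norm_triangle_ineq4[of "T n (x + v)" "T n x"] by (simp add: blinfun.add_right)
      then show ?thesis using r False by (simp add: v_def blinfun.scaleR_right field_simps)
    qed simp
  qed
  then show thesis by (rule that)
qed

section \<open>The Hilbert space and its operators\<close>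

lemma ell2_eqI: "(\<And>x. coord u x = coord v x) \<Longrightarrow> u = v"
  by (simp add: coord_inject[symmetric] ext)

lemma summable_coord: "(\<lambda>x. (cmod (coord u x))\<^sup>2) summable_on UNIV"
  using coord[of u] by simp

lemma sum_coord_le_norm: "finite F \<Longrightarrow> (\<Sum>x\<in>F. (cmod (coord u x))\<^sup>2) \<le> (norm u)\<^sup>2"
  unfolding norm_power2_ell2 by (rule finite_sum_le_infsum) (auto simp: summable_coord)

lemma cmod_coord_le: "cmod (coord u x) \<le> norm u"
  using sum_coord_le_norm[of "{x}" u] by (simp add: power2_le_iff_abs_le)

lemma bounded_linear_coord: "bounded_linear (\<lambda>u. coord u x)"
  by (rule bounded_linear_intro[where K = 1])
    (auto simp: plus_ell2.rep_eq scaleR_ell2.rep_eq scaleR_conv_of_real cmod_coord_le)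

lemma tendsto_coord: "(w \<longlongrightarrow> u) F \<Longrightarrow> ((\<lambda>n. coord (w n) x) \<longlongrightarrow> coord u x) F"
  by (rule bounded_linear.tendsto[OF bounded_linear_coord])

text \<open>Fatou's lemma for \<open>\<ell>\<^sub>2\<close>: the finite partial sums of squares pass to the limit. This
  yields completeness of \<open>\<ell>\<^sub>2\<close>, limits of operators given by their matrix entries, and lower
  semicontinuity of the norm.\<close>

lemma ell2_pointwise_limit:
  assumes lim: "\<And>x. (\<lambda>n. coord (w n) x) \<longlonglongrightarrow> f x"
    and C: "\<forall>\<^sub>F n in sequentially. norm (w n) \<le> C"
  obtains u where "coord u = f" "norm u \<le> C"
proof -
  have "C \<ge> 0"
    using eventually_happens[OF C] by (auto intro: order.trans[OF norm_ge_zero])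
  have bound: "(\<Sum>x\<in>F. (cmod (f x))\<^sup>2) \<le> C\<^sup>2" if "finite F" for F
  proof (rule tendsto_upperbound)
    show "(\<lambda>n. \<Sum>x\<in>F. (cmod (coord (w n) x))\<^sup>2) \<longlonglongrightarrow> (\<Sum>x\<in>F. (cmod (f x))\<^sup>2)"
      by (intro tendsto_intros lim)
    show "\<forall>\<^sub>F n in sequentially. (\<Sum>x\<in>F. (cmod (coord (w n) x))\<^sup>2) \<le> C\<^sup>2"
      using C by eventually_elim
        (rule order.trans[OF sum_coord_le_norm[OF that]], auto intro: power_mono)
  qed simp
  have summ: "(\<lambda>x. (cmod (f x))\<^sup>2) summable_on UNIV"
    by (rule nonneg_bdd_above_summable_on) (use bound in \<open>auto intro!: bdd_aboveI\<close>)
  define u where "u = Abs_ell2 f"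
  have u: "coord u = f" using summ by (simp add: u_def Abs_ell2_inverse)
  have "(norm u)\<^sup>2 \<le> C\<^sup>2"
    unfolding norm_power2_ell2 u by (rule infsum_le_finite_sums[OF summ]) (use bound in auto)
  then have "norm u \<le> C" using \<open>C \<ge> 0\<close> by (rule power2_le_imp_le)
  with u show thesis by (rule that)
qed

instance ell2 :: (type) banach
proof
  fix X :: "nat \<Rightarrow> 'a ell2"
  assume X: "Cauchy X"
  have "Cauchy (\<lambda>n. coord (X n) x)" for x
    by (rule bounded_linear.Cauchy[OF bounded_linear_coord X])
  then have "\<exists>l. (\<lambda>n. coord (X n) x) \<longlonglongrightarrow> l" for x
    by (simp add: Cauchy_convergent_iff convergent_def)
  then obtain f where f: "\<And>x. (\<lambda>n. coord (X n) x) \<longlonglongrightarrow> f x" by metis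
  obtain C where "\<And>n. norm (X n) \<le> C"
    using Cauchy_Bseq[OF X] by (auto simp: Bseq_def)
  then obtain u where u: "coord u = f"
    using ell2_pointwise_limit[OF f, of C] by auto
  have "X \<longlonglongrightarrow> u"
    unfolding LIMSEQ_iff
  proof (intro allI impI)
    fix e :: real assume "e > 0"
    then obtain N where N: "\<And>m n. m \<ge> N \<Longrightarrow> n \<ge> N \<Longrightarrow> norm (X m - X n) < e / 2"
      using CauchyD[OF X, of "e / 2"] by auto
    \<comment> \<open>The bound on \<open>X n - X m\<close> survives the coordinatewise limit in \<open>m\<close>.\<close>
    have "norm (X n - u) < e" if "n \<ge> N" for n
    proof -
      have "(\<lambda>m. coord (X n - X m) x) \<longlonglongrightarrow> coord (X n) x - f x" for x
        unfolding minus_ell2.rep_eq by (intro tendsto_intros f)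
      moreover have "\<forall>\<^sub>F m in sequentially. norm (X n - X m) \<le> e / 2"
        using N that by (auto simp: eventually_sequentially intro!: exI[of _ N] less_imp_le)
      ultimately obtain v where v: "coord v = (\<lambda>x. coord (X n) x - f x)" "norm v \<le> e / 2"
        by (rule ell2_pointwise_limit)
      have "v = X n - u" by (rule ell2_eqI) (simp add: v minus_ell2.rep_eq u)
      with v \<open>e > 0\<close> show ?thesis by simp
    qed
    then show "\<exists>N. \<forall>n\<ge>N. norm (X n - u) < e" by blast
  qed
  then show "convergent X" by (auto simp: convergent_def)
qed

lemma cinner_add_right: "cinner u (v + w) = cinner u v + cinner u w"
  by (metis cinner_add_left cinner_commute complex_cnj_add)

lemma cinner_scaleC_right: "cinner u (scaleC_ell2 c v) = cnj c * cinner u v"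
  by (metis cinner_scaleC_left cinner_commute complex_cnj_mult)

lemma bounded_bilinear_cinner: "bounded_bilinear cinner"
  by standard
    (auto simp: cinner_add_left cinner_add_right scaleR_scaleC_ell2 cinner_scaleC_left
      cinner_scaleC_right scaleR_conv_of_real cinner_bound intro!: exI[of _ 1])

lemma bounded_opsD: "a \<in> bounded_ops \<Longrightarrow> a (scaleC_ell2 c u) = scaleC_ell2 c (a u)"
  by (simp add: bounded_ops_def)

lemma bounded_ops_limit:
  fixes b :: "'a ell2_op"
  assumes "\<And>n. a n \<in> bounded_ops" "\<And>u. (\<lambda>n. a n u) \<longlonglongrightarrow> b u"
  shows "b \<in> bounded_ops"
proof -
  have "b (scaleC_ell2 c u) = scaleC_ell2 c (b u)" for c u
  proof (rule LIMSEQ_unique)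
    show "(\<lambda>n. a n (scaleC_ell2 c u)) \<longlonglongrightarrow> b (scaleC_ell2 c u)" by (rule assms)
    show "(\<lambda>n. a n (scaleC_ell2 c u)) \<longlonglongrightarrow> scaleC_ell2 c (b u)"
      using bounded_linear.tendsto[OF bounded_linear_scaleC_ell2 assms(2)]
      by (simp add: bounded_opsD assms(1))
  qed
  then show ?thesis by (simp add: bounded_ops_def)
qed

lemma scaleC_ell2_add: "scaleC_ell2 c (u + v) = scaleC_ell2 c u + scaleC_ell2 c v"
  by (rule linear_add[OF bounded_linear.linear[OF bounded_linear_scaleC_ell2]])

lemma scaleC_ell2_scaleC: "scaleC_ell2 c (scaleC_ell2 d u) = scaleC_ell2 d (scaleC_ell2 c u)"
  by (rule ell2_eqI) (simp add: scaleC_ell2.rep_eq)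

lemma scaleC_op_of_real: "scaleC_op (of_real t) a = t *\<^sub>R a"
  by (rule blinfun_eqI) (simp add: scaleC_op_apply scaleR_scaleC_ell2 blinfun.scaleR_left)

lemma subspace_bounded_ops: "subspace bounded_ops"
  by (auto simp: subspace_def bounded_ops_def blinfun.add_left blinfun.scaleR_left
      scaleC_ell2_add scaleR_scaleC_ell2 scaleC_ell2_scaleC) (transfer, simp)

lemma bounded_ops_compose: "a \<in> bounded_ops \<Longrightarrow> b \<in> bounded_ops \<Longrightarrow> a o\<^sub>L b \<in> bounded_ops"
  by (simp add: bounded_ops_def)

lemma bounded_ops_scaleC: "a \<in> bounded_ops \<Longrightarrow> scaleC_op c a \<in> bounded_ops"
  by (simp add: bounded_ops_def scaleC_op_apply scaleC_ell2_scaleC)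

lemma cinner_adj: "a \<in> bounded_ops \<Longrightarrow> cinner (a u) v = cinner u (adj a v)"
  by (rule adj_props)

lemma inner_adj: "a \<in> bounded_ops \<Longrightarrow> inner (a u) v = inner u (adj a v)"
  by (simp add: inner_ell2_def cinner_adj)

lemma adj_compose:
  assumes "a \<in> bounded_ops" "b \<in> bounded_ops"
  shows "adj (a o\<^sub>L b) = adj b o\<^sub>L adj a"
  by (rule adj_eqI) (simp add: cinner_adj assms)

lemma adj_diff:
  assumes "a \<in> bounded_ops" "b \<in> bounded_ops"
  shows "adj (a - b) = adj a - adj b"
  by (rule adj_eqI)
    (simp add: cinner_adj assms blinfun.diff_left bounded_bilinear.diff_left[OF bounded_bilinear_cinner]
      bounded_bilinear.diff_right[OF bounded_bilinear_cinner])

lemma norm_adj_le: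
  assumes a: "a \<in> bounded_ops"
  shows "norm (adj a) \<le> norm a"
proof (rule norm_blinfun_bound)
  fix v
  have "norm (adj a v) * norm (adj a v) = inner (a (adj a v)) v"
    by (simp add: inner_adj[OF a] power2_norm_eq_inner flip: power2_eq_square)
  also have "\<dots> \<le> norm (a (adj a v)) * norm v" by (rule norm_cauchy_schwarz)
  also have "\<dots> \<le> (norm a * norm (adj a v)) * norm v"
    by (intro mult_right_mono norm_blinfun) simp
  finally have "norm (adj a v) * norm (adj a v) \<le> norm (adj a v) * (norm a * norm v)"
    by (simp add: mult_ac)
  then show "norm (adj a v) \<le> norm a * norm v"
    by (cases "norm (adj a v) = 0") (auto simp: mult_le_cancel_left)
qed simp

text \<open>The matrix description of an operator; the sum is the inner product with
  the image of a basis vector under the adjoint.\<close>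

lemma coord_apply:
  assumes a: "a \<in> bounded_ops"
  shows "coord (a u) y = (\<Sum>\<^sub>\<infinity>x. coord u x * coord (a (delta x)) y)"
proof -
  have "cnj (coord (adj a (delta y)) x) = coord (a (delta x)) y" for x
    using cinner_adj[OF a, of "delta x" "delta y"]
    by (simp add: cinner_delta cinner_commute[of "delta x"])
  then have "cinner u (adj a (delta y)) = (\<Sum>\<^sub>\<infinity>x. coord u x * coord (a (delta x)) y)"
    by (simp add: cinner.rep_eq)
  then show ?thesis
    using cinner_adj[OF a, of u "delta y"] by (simp add: cinner_delta)
qed

section \<open>Operators of bounded propagation and the uniform Roe algebra\<close>

text \<open>Fixing the propagation bound gives linear spaces that increase with \<open>r\<close>; this is why
  the bound is a parameter here.\<close>

definition banded :: "real \<Rightarrow> 'a::metric_space ell2_op set"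
  where "banded r = {a \<in> bounded_ops. \<forall>x y. dist x y > r \<longrightarrow> coord (a (delta x)) y = 0}"

lemma banded_ops: "a \<in> banded r \<Longrightarrow> a \<in> bounded_ops"
  by (simp add: banded_def)

lemma bandedD: "a \<in> banded r \<Longrightarrow> dist x y > r \<Longrightarrow> coord (a (delta x)) y = 0"
  by (simp add: banded_def)

lemma banded_mono: "r \<le> s \<Longrightarrow> banded r \<subseteq> banded s"
  by (auto simp: banded_def)

lemma uniform_roe_eq: "(uniform_roe :: 'a::metric_space ell2_op set) = closure (\<Union>n. banded (real n))"
proof -
  have "{a :: 'a ell2_op. a \<in> bounded_ops \<and> finite_propagation a} = (\<Union>n. banded (real n))"
  proof (intro equalityI subsetI)
    fix a :: "'a ell2_op" assume "a \<in> {a \<in> bounded_ops. finite_propagation a}"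
    then obtain r where r: "a \<in> banded r"
      by (auto simp: finite_propagation_def banded_def cinner_delta)
    obtain n where "r \<le> real n" using real_arch_simple by blast
    with r show "a \<in> (\<Union>n. banded (real n))" using banded_mono by blast
  next
    fix a :: "'a ell2_op" assume "a \<in> (\<Union>n. banded (real n))"
    then obtain n where n: "a \<in> banded (real n)" by blast
    then have "a \<in> banded (real n + 1)" using banded_mono[of "real n" "real n + 1"] by auto
    then show "a \<in> {a \<in> bounded_ops. finite_propagation a}"
      by (auto simp: finite_propagation_def banded_def cinner_delta intro!: exI[of _ "real n + 1"])
  qed
  then show ?thesis by (simp add: uniform_roe_def)
qed

lemma banded_in_roe:
  assumes "a \<in> banded r"
  shows "a \<in> uniform_roe"
proof -
  obtain n where "r \<le> real n" using real_arch_simple by blast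
  then have "a \<in> banded (real n)" by (rule subsetD[OF banded_mono assms])
  then show ?thesis unfolding uniform_roe_eq by (intro subsetD[OF closure_subset]) (rule UN_I, simp_all)
qed

text \<open>Closure properties of the algebra are inherited from banded operators along such sequences.\<close>

lemma roe_limit_of_banded:
  assumes "a \<in> uniform_roe"
  obtains b r where "\<And>n. b n \<in> banded (r n)" "b \<longlonglongrightarrow> a"
proof -
  obtain b where b: "\<And>n. b n \<in> (\<Union>n. banded (real n))" "b \<longlonglongrightarrow> a"
    using assms unfolding uniform_roe_eq closure_sequential by blast
  then have "\<exists>r. b n \<in> banded r" for n by blast
  then show thesis using that b by metis
qed

lemma closed_uniform_roe: "closed uniform_roe"
  by (simp add: uniform_roe_def)

lemma roe_LIMSEQ: "(\<And>n. b n \<in> uniform_roe) \<Longrightarrow> b \<longlonglongrightarrow> a \<Longrightarrow> a \<in> uniform_roe"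
  using closed_sequentially[OF closed_uniform_roe] by blast

lemma subspace_banded: "subspace (banded r)"
  using subspace_bounded_ops
  by (auto simp: banded_def subspace_def blinfun.add_left blinfun.scaleR_left zero_ell2.rep_eq
      plus_ell2.rep_eq scaleR_ell2.rep_eq)

lemma banded_scaleC: "a \<in> banded r \<Longrightarrow> scaleC_op c a \<in> banded r"
  by (simp add: banded_def bounded_ops_scaleC scaleC_op_apply scaleC_ell2.rep_eq)

text \<open>In the sum over intermediate points \<open>z\<close>, one of the distances \<open>d(x,z)\<close> and
  \<open>d(z,y)\<close> is too large.\<close>

lemma banded_compose:
  assumes a: "a \<in> banded r" and b: "b \<in> banded s"
  shows "a o\<^sub>L b \<in> banded (r + s)"
  unfolding banded_def
proof (intro CollectI conjI allI impI)
  show "a o\<^sub>L b \<in> bounded_ops" using a b by (intro bounded_ops_compose banded_ops)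
  fix x y :: 'a assume far: "dist x y > r + s"
  have "coord (b (delta x)) z * coord (a (delta z)) y = 0" for z
  proof -
    have "dist x z > s \<or> dist z y > r"
      using far dist_triangle[of x y z] by linarith
    then show ?thesis using bandedD[OF a, of z y] bandedD[OF b, of x z] by auto
  qed
  then show "coord ((a o\<^sub>L b) (delta x)) y = 0"
    unfolding blinfun_apply_blinfun_compose coord_apply[OF banded_ops[OF a], of "b (delta x)"]
    by (rule infsum_0)
qed

lemma banded_adj:
  assumes a: "a \<in> banded r"
  shows "adj a \<in> banded r"
  unfolding banded_def
proof (intro CollectI conjI allI impI)
  show "adj a \<in> bounded_ops" by (rule adj_props(1)[OF banded_ops[OF a]])
  fix x y :: 'a assume "dist x y > r"
  then have "coord (a (delta y)) x = 0" by (intro bandedD[OF a]) (simp add: dist_commute)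
  then show "coord (adj a (delta x)) y = 0"
    using cinner_adj[OF banded_ops[OF a], of "delta y" "delta x"]
    by (simp add: cinner_delta cinner_commute[of "delta y"])
qed

lemma roe_bounded_ops: "a \<in> uniform_roe \<Longrightarrow> a \<in> bounded_ops"
proof -
  assume "a \<in> uniform_roe"
  then obtain b r where b: "\<And>n. b n \<in> banded (r n)" "b \<longlonglongrightarrow> a" by (rule roe_limit_of_banded) blast
  show ?thesis
    by (rule bounded_ops_limit[of b]) (use b in \<open>auto intro: banded_ops intro!: blinfun.tendsto tendsto_const\<close>)
qed

lemma roe_scaleC:
  assumes "a \<in> uniform_roe"
  shows "scaleC_op c a \<in> uniform_roe"
proof -
  obtain b r where b: "\<And>n. b n \<in> banded (r n)" "b \<longlonglongrightarrow> a" using assms by (rule roe_limit_of_banded) blast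
  have bl: "bounded_linear (scaleC_op c :: 'a ell2_op \<Rightarrow> _)"
  proof (rule bounded_linear_intro)
    show "scaleC_op c (a + b) = scaleC_op c a + scaleC_op c b" for a b :: "'a ell2_op"
      by (rule blinfun_eqI) (simp add: scaleC_op_apply blinfun.add_left scaleC_ell2_add)
    show "scaleC_op c (t *\<^sub>R a) = t *\<^sub>R scaleC_op c a" for t and a :: "'a ell2_op"
      by (rule blinfun_eqI)
        (simp add: scaleC_op_apply blinfun.scaleR_left scaleR_scaleC_ell2 scaleC_ell2_scaleC)
    show "norm (scaleC_op c a) \<le> norm a * cmod c" for a :: "'a ell2_op"
    proof (rule norm_blinfun_bound)
      show "norm (scaleC_op c a u) \<le> norm a * cmod c * norm u" for u
        using mult_left_mono[OF norm_blinfun[of a u], of "cmod c"]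
        by (simp add: scaleC_op_apply norm_scaleC_ell2 mult_ac)
    qed simp
  qed
  show ?thesis
    by (rule roe_LIMSEQ[OF _ bounded_linear.tendsto[OF bl b(2)]]) (rule banded_in_roe[OF banded_scaleC[OF b(1)]])
qed

lemma banded_add: "a \<in> banded r \<Longrightarrow> b \<in> banded s \<Longrightarrow> a + b \<in> banded (max r s)"
  using banded_mono[of r "max r s"] banded_mono[of s "max r s"]
  by (intro subspace_add[OF subspace_banded]) auto

lemma subspace_uniform_roe: "subspace uniform_roe"
  unfolding subspace_def
proof (intro conjI ballI allI)
  show "0 \<in> uniform_roe" by (rule banded_in_roe[OF subspace_0[OF subspace_banded, of 0]])
next
  fix a a' :: "'a ell2_op" assume a: "a \<in> uniform_roe" and a': "a' \<in> uniform_roe"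
  obtain b r where b: "\<And>n. b n \<in> banded (r n)" "b \<longlonglongrightarrow> a" using a by (rule roe_limit_of_banded) blast
  obtain b' r' where b': "\<And>n. b' n \<in> banded (r' n)" "b' \<longlonglongrightarrow> a'" using a' by (rule roe_limit_of_banded) blast
  show "a + a' \<in> uniform_roe"
    by (rule roe_LIMSEQ[OF _ tendsto_add[OF b(2) b'(2)]])
      (rule banded_in_roe[OF banded_add[OF b(1) b'(1)]])
next
  fix t and a :: "'a ell2_op" assume "a \<in> uniform_roe"
  then show "t *\<^sub>R a \<in> uniform_roe" using roe_scaleC[of a "of_real t"] by (simp add: scaleC_op_of_real)
qed

lemma roe_compose:
  assumes "a \<in> uniform_roe" "a' \<in> uniform_roe"
  shows "a o\<^sub>L a' \<in> uniform_roe"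
proof -
  obtain b r where b: "\<And>n. b n \<in> banded (r n)" "b \<longlonglongrightarrow> a" using assms(1) by (rule roe_limit_of_banded) blast
  obtain b' r' where b': "\<And>n. b' n \<in> banded (r' n)" "b' \<longlonglongrightarrow> a'"
    using assms(2) by (rule roe_limit_of_banded) blast
  have "(\<lambda>n. b n o\<^sub>L b' n) \<longlonglongrightarrow> (a o\<^sub>L a')"
    by (rule bounded_bilinear.tendsto[OF bounded_bilinear_blinfun_compose b(2) b'(2)])
  then show ?thesis by (rule roe_LIMSEQ[rotated]) (rule banded_in_roe[OF banded_compose[OF b(1) b'(1)]])
qed

lemma roe_adj:
  assumes a: "a \<in> uniform_roe"
  shows "adj a \<in> uniform_roe"
proof -
  obtain b r where b: "\<And>n. b n \<in> banded (r n)" "b \<longlonglongrightarrow> a" using a by (rule roe_limit_of_banded) blast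
  have "(\<lambda>n. adj (b n)) \<longlonglongrightarrow> adj a"
  proof (rule LIM_zero_cancel, rule Lim_null_comparison)
    show "(\<lambda>n. norm (b n - a)) \<longlonglongrightarrow> 0" using b(2) by (intro tendsto_norm_zero LIM_zero)
    show "\<forall>\<^sub>F n in sequentially. norm (adj (b n) - adj a) \<le> norm (b n - a)"
    proof (intro always_eventually allI)
      fix n
      have *: "b n \<in> bounded_ops" "a \<in> bounded_ops" by (rule banded_ops[OF b(1)], rule roe_bounded_ops[OF a])
      then show "norm (adj (b n) - adj a) \<le> norm (b n - a)"
        using norm_adj_le[OF subspace_diff[OF subspace_bounded_ops *]] by (simp add: adj_diff)
    qed
  qed
  then show ?thesis by (rule roe_LIMSEQ[rotated]) (rule banded_in_roe[OF banded_adj[OF b(1)]])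
qed

section \<open>Coordinate projections\<close>

lift_definition restrict_ell2 :: "'a set \<Rightarrow> 'a ell2 \<Rightarrow> 'a ell2" is "\<lambda>A f x. if x \<in> A then f x else 0"
  by (rule summable_on_comparison_test) auto

definition chi :: "'a set \<Rightarrow> 'a ell2_op"
  where "chi A = Blinfun (restrict_ell2 A)"

lemma chi_apply: "coord (chi A u) x = (if x \<in> A then coord u x else 0)"
proof -
  have "bounded_linear (restrict_ell2 A)"
  proof (rule bounded_linear_intro)
    show "norm (restrict_ell2 A u) \<le> norm u * 1" for u
      unfolding norm_ell2_def
      by (auto intro!: infsum_mono summable_coord simp: restrict_ell2.rep_eq real_sqrt_le_iff)
        (use summable_coord[of "restrict_ell2 A u"] in \<open>simp add: restrict_ell2.rep_eq\<close>)
  qed (rule ell2_eqI; simp add: restrict_ell2.rep_eq plus_ell2.rep_eq scaleR_ell2.rep_eq)+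
  then show ?thesis by (simp add: chi_def bounded_linear_Blinfun_apply restrict_ell2.rep_eq)
qed

lemma chi_bounded_ops: "chi A \<in> bounded_ops"
  by (auto simp: bounded_ops_def chi_apply scaleC_ell2.rep_eq intro!: ell2_eqI)

lemma chi_in_banded: "chi A \<in> banded 0"
  by (auto simp: banded_def chi_bounded_ops chi_apply delta.rep_eq)

lemma chi_in_roe: "chi A \<in> uniform_roe"
  by (rule banded_in_roe[OF chi_in_banded])

lemma chi_compose: "chi A o\<^sub>L chi B = chi (A \<inter> B)"
  by (intro blinfun_eqI ell2_eqI) (simp add: chi_apply)

lemma chi_Un: "A \<inter> B = {} \<Longrightarrow> chi (A \<union> B) = chi A + chi B"
  by (intro blinfun_eqI ell2_eqI) (auto simp: chi_apply blinfun.add_left plus_ell2.rep_eq)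

lemma chi_UNIV: "chi UNIV = id_blinfun"
  by (intro blinfun_eqI ell2_eqI) (simp add: chi_apply)

lemma adj_chi: "adj (chi A) = chi A"
  by (rule adj_eqI) (auto simp: cinner.rep_eq chi_apply intro!: infsum_cong)

lemma chi_nonzero: "chi {x} \<noteq> 0"
proof
  assume "chi {x} = 0"
  then have "coord (chi {x} (delta x)) x = 0" by (simp add: zero_ell2.rep_eq)
  then show False by (simp add: chi_apply delta.rep_eq)
qed

text \<open>An operator of propagation at most \<open>r\<close> moves supports by at most \<open>r\<close>, and the same holds
  for its adjoint.\<close>

lemma banded_chi:
  assumes a: "a \<in> banded r" and AB: "\<And>x y. x \<in> A \<Longrightarrow> dist x y \<le> r \<Longrightarrow> y \<in> B"
  shows "chi B o\<^sub>L a o\<^sub>L chi A = a o\<^sub>L chi A" "chi A o\<^sub>L a o\<^sub>L chi B = chi A o\<^sub>L a"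
proof -
  note ca = coord_apply[OF banded_ops[OF a]]
  have z: "coord (chi A u) x * coord (a (delta x)) y = 0" if "y \<notin> B" for u x y
    using AB[of x y] that bandedD[OF a, of x y] by (cases "x \<in> A"; cases "dist x y \<le> r") (auto simp: chi_apply)
  have "coord (a (chi A u)) y = 0" if "y \<notin> B" for u y
    unfolding ca[of "chi A u" y] by (rule infsum_0) (rule z[OF that])
  then show "chi B o\<^sub>L a o\<^sub>L chi A = a o\<^sub>L chi A"
    by (intro blinfun_eqI ell2_eqI) (simp add: chi_apply)
  have e: "coord (chi B u) x * coord (a (delta x)) y = coord u x * coord (a (delta x)) y"
    if "y \<in> A" for u x y
    using AB[of y x] that bandedD[OF a, of x y]
    by (cases "x \<in> B"; cases "dist x y \<le> r") (auto simp: chi_apply dist_commute)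
  have "coord (a (chi B u)) y = coord (a u) y" if "y \<in> A" for u y
    unfolding ca[of "chi B u" y] ca[of u y] by (rule infsum_cong) (rule e[OF that])
  then show "chi A o\<^sub>L a o\<^sub>L chi B = chi A o\<^sub>L a"
    by (intro blinfun_eqI ell2_eqI) (simp add: chi_apply)
qed

text \<open>Below a finite-rank coordinate projection, strong convergence is norm
  convergence: only finitely many basis vectors matter.\<close>

lemma chi_finite_SOT_norm:
  assumes F: "finite F" and a: "\<And>k. a k \<in> bounded_ops" and lim: "\<And>u. (\<lambda>k. a k u) \<longlonglongrightarrow> 0"
  shows "(\<lambda>k. a k o\<^sub>L chi F) \<longlonglongrightarrow> 0"
proof (rule Lim_null_comparison)
  show "(\<lambda>k. \<Sum>x\<in>F. norm (a k (delta x))) \<longlonglongrightarrow> 0"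
    using lim by (intro tendsto_null_sum tendsto_norm_zero)
  show "\<forall>\<^sub>F k in sequentially. norm (a k o\<^sub>L chi F) \<le> (\<Sum>x\<in>F. norm (a k (delta x)))"
  proof (intro always_eventually allI norm_blinfun_bound)
    fix k u
    have "chi F u = (\<Sum>x\<in>F. scaleC_ell2 (coord u x) (delta x))"
      by (rule ell2_eqI) (simp add: chi_apply coord_sum_delta F)
    then have "(a k o\<^sub>L chi F) u = (\<Sum>x\<in>F. scaleC_ell2 (coord u x) (a k (delta x)))"
      by (simp add: blinfun.sum_right bounded_opsD a)
    also have "norm \<dots> \<le> (\<Sum>x\<in>F. norm (a k (delta x)) * norm u)"
      by (rule sum_norm_le)
        (simp add: norm_scaleC_ell2 mult.commute[of _ "norm u"] mult_right_mono cmod_coord_le)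
    finally show "norm ((a k o\<^sub>L chi F) u) \<le> (\<Sum>x\<in>F. norm (a k (delta x))) * norm u"
      by (simp add: sum_distrib_right)
  qed (simp add: sum_nonneg)
qed

section \<open>Weak limits of operators of bounded propagation\<close>

lemma ulf_finite_cball: "uniformly_locally_finite TYPE('a::metric_space) \<Longrightarrow> finite (cball (x::'a) r)"
proof -
  assume "uniformly_locally_finite TYPE('a)"
  then have "finite (cball x (max r 1))"
    unfolding uniformly_locally_finite_def by (metis less_max_iff_disj zero_less_one)
  then show ?thesis by (rule rev_finite_subset) auto
qed

lemma UN_cball_nat: "(\<Union>n. cball (x::'a::metric_space) (real n)) = UNIV"
  by (auto simp: real_arch_simple)

lemma ulf_countable:
  assumes "uniformly_locally_finite TYPE('a::metric_space)"
  shows "countable (UNIV :: 'a set)"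
proof -
  have "countable (\<Union>n. cball (undefined :: 'a) (real n))"
    by (rule countable_UN) (simp_all add: countable_finite ulf_finite_cball[OF assms])
  then show ?thesis by (simp only: UN_cball_nat)
qed

lemma banded_coord_apply:
  assumes a: "a \<in> banded r" and fin: "finite (cball y r)"
  shows "coord (a u) y = (\<Sum>x\<in>cball y r. coord u x * coord (a (delta x)) y)"
proof -
  have "coord (a u) y = (\<Sum>\<^sub>\<infinity>x\<in>cball y r. coord u x * coord (a (delta x)) y)"
    unfolding coord_apply[OF banded_ops[OF a], of u y]
    by (rule infsum_cong_neutral) (auto simp: dist_commute not_le bandedD[OF a])
  then show ?thesis using fin by simp
qed

lemma norm_delta: "norm (delta x) = 1"
  by (simp add: norm_eq_sqrt_inner inner_ell2_def cinner_delta delta.rep_eq)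

text \<open>The rows of a banded matrix have uniformly located finite support, so that convergence of the
  matrix entries along a diagonal subsequence gives convergence of all coordinates of
  \<open>c (k n) u\<close> by finite sums. The bound on the norms then makes the limit an operator.\<close>

lemma banded_compact:
  fixes c :: "nat \<Rightarrow> 'a::metric_space ell2_op"
  assumes ulf: "uniformly_locally_finite TYPE('a)"
    and c: "\<And>n. c n \<in> banded r" and K: "\<And>n. norm (c n) \<le> K"
  obtains k d where "strict_mono (k :: nat \<Rightarrow> nat)" "d \<in> banded r"
    "\<And>u y. (\<lambda>n. coord (c (k n) u) y) \<longlonglongrightarrow> coord (d u) y"
proof -
  note fin = ulf_finite_cball[OF ulf]
  have cnt: "countable (UNIV :: ('a \<times> 'a) set)"
    using countable_SIGMA[OF ulf_countable[OF ulf] ulf_countable[OF ulf]] by simp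
  have bd: "norm (coord (c n (delta (fst z))) (snd z)) \<le> K" for n z
    using cmod_coord_le[of "c n (delta (fst z))" "snd z"] norm_blinfun[of "c n" "delta (fst z)"] K[of n]
    by (simp add: norm_delta)
  have "\<exists>k. strict_mono (k :: nat \<Rightarrow> nat) \<and>
      (\<forall>z\<in>UNIV. \<exists>l. (\<lambda>n. coord (c (k n) (delta (fst z))) (snd z)) \<longlonglongrightarrow> l)"
    by (rule function_convergent_subsequence[OF cnt, of "\<lambda>n z. coord (c n (delta (fst z))) (snd z)" K])
      (rule bd, blast)
  then obtain k where k: "strict_mono (k :: nat \<Rightarrow> nat)"
    and "\<forall>z. \<exists>l. (\<lambda>n. coord (c (k n) (delta (fst z))) (snd z)) \<longlonglongrightarrow> l" by blast
  from choice[OF this(2)] obtain l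
    where "\<And>z. (\<lambda>n. coord (c (k n) (delta (fst z))) (snd z)) \<longlonglongrightarrow> l z" by blast
  from this[of "(x, y)" for x y] have l: "(\<lambda>n. coord (c (k n) (delta x)) y) \<longlonglongrightarrow> l (x, y)" for x y
    by simp
  define g where "g u y = (\<Sum>x\<in>cball y r. coord u x * l (x, y))" for u y
  have lim: "(\<lambda>n. coord (c (k n) u) y) \<longlonglongrightarrow> g u y" for u y
    unfolding g_def banded_coord_apply[OF c fin, of _ u y] by (intro tendsto_intros l)
  have "\<exists>w. coord w = g u \<and> norm w \<le> norm u * K" for u
  proof -
    have "norm (c (k n) u) \<le> norm u * K" for n
      using norm_blinfun[of "c (k n)" u] mult_left_mono[OF K[of "k n"], of "norm u"]
      by (simp add: mult.commute)
    then have "\<forall>\<^sub>F n in sequentially. norm (c (k n) u) \<le> norm u * K" by simp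
    with lim obtain w where "coord w = g u" "norm w \<le> norm u * K" by (rule ell2_pointwise_limit)
    then show ?thesis by blast
  qed
  then obtain w where w: "\<And>u. coord (w u) = g u" "\<And>u. norm (w u) \<le> norm u * K" by metis
  have wscale: "w (scaleC_ell2 s u) = scaleC_ell2 s (w u)" for s u
    by (rule ell2_eqI) (simp add: w g_def scaleC_ell2.rep_eq sum_distrib_left mult.assoc)
  have "bounded_linear w"
  proof (rule bounded_linear_intro)
    show "w (u + v) = w u + w v" for u v
      by (rule ell2_eqI) (simp add: w g_def plus_ell2.rep_eq distrib_right sum.distrib)
    show "w (t *\<^sub>R u) = t *\<^sub>R w u" for t u by (simp add: scaleR_scaleC_ell2 wscale)
  qed (rule w)
  then have app: "blinfun_apply (Blinfun w) = w" by (rule bounded_linear_Blinfun_apply)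
  have "Blinfun w \<in> banded r"
    unfolding banded_def
  proof (intro CollectI conjI allI impI)
    show "Blinfun w \<in> bounded_ops" by (simp add: bounded_ops_def app wscale)
    fix x y :: 'a assume "dist x y > r"
    then show "coord (Blinfun w (delta x)) y = 0"
      by (auto simp: app w g_def delta.rep_eq dist_commute intro!: sum.neutral)
  qed
  with k lim show thesis by (intro that[of k "Blinfun w"]) (simp_all add: app w)
qed

text \<open>Approximants \<open>c n\<close> of \<open>P n\<close> with a common propagation bound have a weak limit point
  \<open>d\<close> with the same bound, and \<open>p - d\<close>, as a weak limit of \<open>P n - c n\<close>, inherits the estimate in
  norm.\<close>

lemma roe_if_uniformly_banded:
  fixes P :: "nat \<Rightarrow> 'a::metric_space ell2_op" and p :: "'a ell2_op"
  assumes ulf: "uniformly_locally_finite TYPE('a)"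
    and K: "\<And>n. norm (P n) \<le> K" and lim: "\<And>u. (\<lambda>n. P n u) \<longlonglongrightarrow> p u"
    and approx: "\<And>\<epsilon>. \<epsilon> > 0 \<Longrightarrow> \<exists>r. \<forall>n. infdist (P n) (banded r) \<le> \<epsilon>"
  shows "p \<in> uniform_roe"
proof -
  have "\<exists>d\<in>uniform_roe. dist d p < e" if "e > 0" for e
  proof -
    obtain r where r: "\<And>n. infdist (P n) (banded r) \<le> e / 4"
      using approx[of "e / 4"] \<open>e > 0\<close> by auto
    have ne: "banded r \<noteq> ({} :: 'a ell2_op set)" using subspace_0[OF subspace_banded] by blast
    have "\<exists>c\<in>banded r. dist (P n) c < e / 2" for n
    proof -
      have "(INF c\<in>banded r. dist (P n) c) < e / 2"
        using r[of n] \<open>e > 0\<close> by (simp add: infdist_notempty[OF ne])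
      then show ?thesis using ne by (subst (asm) cINF_less_iff) auto
    qed
    then obtain c where c: "\<And>n. c n \<in> banded r" "\<And>n. dist (P n) (c n) < e / 2" by metis
    have "norm (c n) \<le> K + e / 2" for n
      using c(2)[of n] K[of n] norm_triangle_ineq2[of "c n" "P n"] by (simp add: dist_norm norm_minus_commute)
    then obtain k d where k: "strict_mono k" and d: "d \<in> banded r"
      and kd: "\<And>u y. (\<lambda>n. coord (c (k n) u) y) \<longlonglongrightarrow> coord (d u) y"
      by (rule banded_compact[where c = c, OF ulf c(1)]) blast
    have "norm (p - d) \<le> e / 2"
    proof (rule norm_blinfun_bound)
      fix u
      have Pk: "(\<lambda>n. P (k n) u) \<longlonglongrightarrow> p u"
        using LIMSEQ_subseq_LIMSEQ[OF lim k] by (simp add: o_def)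
      have "(\<lambda>n. coord ((P (k n) - c (k n)) u) y) \<longlonglongrightarrow> coord (p u) y - coord (d u) y" for y
        unfolding blinfun.diff_left minus_ell2.rep_eq by (rule tendsto_diff[OF tendsto_coord[OF Pk] kd])
      moreover have "\<forall>\<^sub>F n in sequentially. norm ((P (k n) - c (k n)) u) \<le> e / 2 * norm u"
      proof (intro always_eventually allI)
        fix n
        show "norm ((P (k n) - c (k n)) u) \<le> e / 2 * norm u"
          using norm_blinfun[of "P (k n) - c (k n)" u] c(2)[of "k n"]
            mult_right_mono[of "norm (P (k n) - c (k n))" "e / 2" "norm u"]
          by (simp add: dist_norm)
      qed
      ultimately obtain v where v: "coord v = (\<lambda>y. coord (p u) y - coord (d u) y)" "norm v \<le> e / 2 * norm u"
        by (rule ell2_pointwise_limit)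
      have "v = (p - d) u" by (rule ell2_eqI) (simp add: v minus_ell2.rep_eq blinfun.diff_left)
      with v show "norm ((p - d) u) \<le> e / 2 * norm u" by simp
    qed (use \<open>e > 0\<close> in simp)
    then show ?thesis using banded_in_roe[OF d] \<open>e > 0\<close>
      by (intro bexI[of _ d]) (auto simp: dist_norm norm_minus_commute)
  qed
  then show ?thesis
    using closed_approachable[OF closed_uniform_roe] by blast
qed

section \<open>Strong limits of operators\<close>

lemma limitin_SOT_iff:
  "limitin strong_operator_topology a l sequentially \<longleftrightarrow> (\<forall>u. (\<lambda>k. a k u) \<longlonglongrightarrow> l u)"
proof
  assume L: "limitin strong_operator_topology a l sequentially"
  show "\<forall>u. (\<lambda>k. a k u) \<longlonglongrightarrow> l u"
  proof
    fix u
    show "(\<lambda>k. a k u) \<longlonglongrightarrow> l u"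
      using continuous_map_limit[OF strong_operator_topology_continuous_evaluation L, of u]
      by (simp add: o_def)
  qed
next
  assume R: "\<forall>u. (\<lambda>k. a k u) \<longlonglongrightarrow> l u"
  have "limitin euclidean (\<lambda>k. blinfun_apply (a k)) (blinfun_apply l) sequentially"
    unfolding euclidean_product_topology[symmetric] limitin_componentwise using R by simp
  then show "limitin strong_operator_topology a l sequentially"
    unfolding limitin_def strong_operator_topology_topspace
    by (auto simp: strong_operator_topology_def openin_pullback_topology)
qed

lemma compose_assoc: "(a o\<^sub>L b) o\<^sub>L c = a o\<^sub>L (b o\<^sub>L c)"
  by (rule blinfun_eqI) simp

lemma projection_norm_le:
  assumes "projection p"
  shows "norm (p u) \<le> norm u"
proof -
  have p: "p \<in> bounded_ops" "p (p u) = p u" "adj p = p"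
    using assms by (auto simp: projection_def blinfun_apply_blinfun_compose[symmetric])
  have "norm (p u) * norm (p u) = inner u (p u)"
    using inner_adj[OF p(1), of u "p u"] p(2,3)
    by (simp add: power2_norm_eq_inner flip: power2_eq_square)
  also have "\<dots> \<le> norm u * norm (p u)" by (rule norm_cauchy_schwarz)
  finally show ?thesis
    by (cases "norm (p u) = 0") (auto simp: mult_le_cancel_right)
qed

text \<open>By Pythagoras, \<open>norm (P m u - P n u)\<close> is controlled by the bounded increasing sequence
  of the numbers \<open>norm (P n u)\<close> squared, so \<open>P n u\<close> is a Cauchy sequence.\<close>

lemma increasing_projections_limit:
  fixes P :: "nat \<Rightarrow> 'a ell2_op"
  assumes P: "\<And>n. projection (P n)" and inc: "\<And>m n. n \<le> m \<Longrightarrow> P m o\<^sub>L P n = P n \<and> P n o\<^sub>L P m = P n"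
  shows "\<exists>p. projection p \<and> (\<forall>u. (\<lambda>n. P n u) \<longlonglongrightarrow> p u) \<and> (\<forall>n. p o\<^sub>L P n = P n \<and> P n o\<^sub>L p = P n)"
proof -
  have Pb: "P n \<in> bounded_ops" and Pa: "adj (P n) = P n" for n
    using P[of n] by (auto simp: projection_def)
  have inc': "P m (P n u) = P n u" "P n (P m u) = P n u" if "n \<le> m" for m n u
    using inc[OF that] by (metis blinfun_apply_blinfun_compose)+
  have sym: "inner (P n w) v = inner w (P n v)" for n v w
    using inner_adj[OF Pb[of n], of w v] by (simp add: Pa)
  have pyth: "(norm (P m u - P n u))\<^sup>2 = (norm (P m u))\<^sup>2 - (norm (P n u))\<^sup>2" if "n \<le> m" for m n u
  proof -
    have "inner (P m u) (P n u) = inner (P n u) u"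
      using sym[of n "P m u" u] inc'[OF that] by simp
    moreover have "inner (P n u) (P n u) = inner (P n u) u"
      using sym[of n "P n u" u] inc'[of n n] by simp
    ultimately show ?thesis
      by (simp add: power2_norm_eq_inner inner_diff_left inner_diff_right inner_commute)
  qed
  have "convergent (\<lambda>n. P n u)" for u
  proof -
    let ?f = "\<lambda>n. (norm (P n u))\<^sup>2"
    have "incseq ?f"
      unfolding incseq_def
    proof (intro allI impI)
      fix n m :: nat assume "n \<le> m"
      then show "?f n \<le> ?f m" using pyth[of n m u] zero_le_power2[of "norm (P m u - P n u)"] by simp
    qed
    moreover have "\<forall>n. ?f n \<le> (norm u)\<^sup>2" by (intro allI power_mono projection_norm_le P) simp
    ultimately obtain L where "?f \<longlonglongrightarrow> L" by (rule incseq_convergent)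
    then have "convergent ?f" by (rule convergentI)
    then have C: "Cauchy ?f" by (rule convergent_Cauchy)
    have "Cauchy (\<lambda>n. P n u)"
    proof (rule CauchyI)
      fix e :: real assume e: "e > 0"
      then obtain N where N: "\<And>m n. m \<ge> N \<Longrightarrow> n \<ge> N \<Longrightarrow> norm (?f m - ?f n) < e\<^sup>2"
        using CauchyD[OF C, of "e\<^sup>2"] by auto
      have le: "norm (P m u - P n u) < e" if "n \<le> m" "n \<ge> N" for m n
        using N[of m n] pyth[OF that(1), of u] that e
        by (intro power2_less_imp_less[of _ e]) auto
      show "\<exists>M. \<forall>m\<ge>M. \<forall>n\<ge>M. norm (P m u - P n u) < e"
      proof (intro exI[of _ N] allI impI)
        fix m n assume "m \<ge> N" "n \<ge> N"
        then show "norm (P m u - P n u) < e"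
          using le[of n m] le[of m n] by (cases "n \<le> m") (simp_all add: norm_minus_commute)
      qed
    qed
    then show ?thesis by (simp add: Cauchy_convergent_iff)
  qed
  then obtain q where q: "\<And>u. (\<lambda>n. P n u) \<longlonglongrightarrow> q u" unfolding convergent_def by metis
  have "bounded_linear q"
  proof (rule bounded_linear_intro)
    show "q (u + v) = q u + q v" for u v
      using tendsto_add[OF q q, of u v] q[of "u + v"] by (auto simp: blinfun.add_right intro: LIMSEQ_unique)
    show "q (t *\<^sub>R u) = t *\<^sub>R q u" for t u
      using tendsto_scaleR[OF tendsto_const q, of t u] q[of "t *\<^sub>R u"]
      by (auto simp: blinfun.scaleR_right intro: LIMSEQ_unique)
    show "norm (q u) \<le> norm u * 1" for u
      by (rule tendsto_upperbound[OF tendsto_norm[OF q]]) (auto simp: projection_norm_le P)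
  qed
  then have app: "blinfun_apply (Blinfun q) = q" by (rule bounded_linear_Blinfun_apply)
  define p where "p = Blinfun q"
  have lim: "(\<lambda>n. P n u) \<longlonglongrightarrow> p u" for u using q by (simp add: p_def app)
  have pP: "p (P n u) = P n u" for n u
  proof (rule LIMSEQ_unique[OF lim])
    show "(\<lambda>m. P m (P n u)) \<longlonglongrightarrow> P n u"
      by (rule tendsto_eventually) (use inc' in \<open>auto simp: eventually_sequentially intro!: exI[of _ n]\<close>)
  qed
  have Pp: "P n (p u) = P n u" for n u
  proof (rule LIMSEQ_unique)
    show "(\<lambda>m. P n (P m u)) \<longlonglongrightarrow> P n (p u)" by (intro blinfun.tendsto tendsto_const lim)
    show "(\<lambda>m. P n (P m u)) \<longlonglongrightarrow> P n u"
      by (rule tendsto_eventually) (use inc' in \<open>auto simp: eventually_sequentially intro!: exI[of _ n]\<close>)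
  qed
  have "projection p"
    unfolding projection_def
  proof (intro conjI)
    show "p \<in> bounded_ops" by (rule bounded_ops_limit[OF Pb lim])
    have "p (p u) = p u" for u using lim[of "p u"] lim[of u] unfolding Pp by (rule LIMSEQ_unique)
    then show "p o\<^sub>L p = p" by (intro blinfun_eqI) simp
    show "adj p = p"
    proof (rule adj_eqI, rule LIMSEQ_unique)
      fix u v
      show "(\<lambda>n. cinner (P n u) v) \<longlonglongrightarrow> cinner (p u) v"
        by (intro bounded_bilinear.tendsto[OF bounded_bilinear_cinner] lim tendsto_const)
      show "(\<lambda>n. cinner (P n u) v) \<longlonglongrightarrow> cinner u (p v)"
        unfolding cinner_adj[OF Pb] Pa
        by (intro bounded_bilinear.tendsto[OF bounded_bilinear_cinner] lim tendsto_const)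
    qed
  qed
  moreover have "p o\<^sub>L P n = P n \<and> P n o\<^sub>L p = P n" for n
    using pP Pp by (auto intro!: blinfun_eqI)
  ultimately show ?thesis using lim by blast
qed

section \<open>Star homomorphisms between uniform Roe algebras\<close>

context
  fixes \<Phi> :: "'x::metric_space ell2_op \<Rightarrow> 'y::metric_space ell2_op"
  assumes hom: "star_hom uniform_roe uniform_roe \<Phi>"
begin

lemma hom_roe: "a \<in> uniform_roe \<Longrightarrow> \<Phi> a \<in> uniform_roe"
  and hom_add: "a \<in> uniform_roe \<Longrightarrow> b \<in> uniform_roe \<Longrightarrow> \<Phi> (a + b) = \<Phi> a + \<Phi> b"
  and hom_scaleC: "a \<in> uniform_roe \<Longrightarrow> \<Phi> (scaleC_op c a) = scaleC_op c (\<Phi> a)"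
  and hom_compose: "a \<in> uniform_roe \<Longrightarrow> b \<in> uniform_roe \<Longrightarrow> \<Phi> (a o\<^sub>L b) = \<Phi> a o\<^sub>L \<Phi> b"
  and hom_adj: "a \<in> uniform_roe \<Longrightarrow> \<Phi> (adj a) = adj (\<Phi> a)"
  using hom by (auto simp: star_hom_def)

lemma hom_scaleR: "a \<in> uniform_roe \<Longrightarrow> \<Phi> (t *\<^sub>R a) = t *\<^sub>R \<Phi> a"
  using hom_scaleC[of a "of_real t"] by (simp add: scaleC_op_of_real)

lemma hom_diff:
  assumes "a \<in> uniform_roe" "b \<in> uniform_roe"
  shows "\<Phi> (a - b) = \<Phi> a - \<Phi> b"
  using hom_add[OF assms(1) subspace_scale[OF subspace_uniform_roe assms(2)], of "-1"]
    hom_scaleR[OF assms(2), of "-1"] by simp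

lemma projection_hom_chi: "projection (\<Phi> (chi A))"
  unfolding projection_def
  using hom_compose[OF chi_in_roe chi_in_roe, of A A] hom_adj[OF chi_in_roe, of A]
  by (simp add: chi_compose adj_chi roe_bounded_ops hom_roe chi_in_roe)

text \<open>Suppose that \<open>\<beta> = norm (\<Phi> a)\<close> exceeds \<open>norm a\<close>, and put \<open>h = adj a a / \<beta>\<^sup>2\<close>. Then
  \<open>1 - h\<close> has a left inverse \<open>k\<close> in the algebra, since \<open>h\<close> has norm less than one. Applying
  \<open>\<Phi>\<close>, the operator \<open>\<Phi> k\<close> inverts \<open>1 - \<Phi> h\<close> on the range of the projection \<open>\<Phi> 1\<close>, so
  \<open>1 - \<Phi> h\<close> is bounded below there. But \<open>\<Phi> a\<close> nearly attains its norm at some unit vectors of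
  that range, and \<open>1 - \<Phi> h\<close> is nearly \<open>0\<close> on them.\<close>

lemma hom_norm_le:
  assumes a: "a \<in> uniform_roe"
  shows "norm (\<Phi> a) \<le> norm a"
proof (rule ccontr)
  assume "\<not> ?thesis"
  then have lt: "norm a < norm (\<Phi> a)" by simp
  define b where "b = \<Phi> a"
  define \<beta> where "\<beta> = norm b"
  define t where "t = 1 / \<beta>\<^sup>2"
  have \<beta>: "\<beta> > 0" "norm a < \<beta>" using lt by (auto simp: \<beta>_def b_def intro: le_less_trans[OF norm_ge_zero])
  have t: "t > 0" "t * \<beta>\<^sup>2 = 1" using \<beta> by (auto simp: t_def)
  have bB: "b \<in> bounded_ops" unfolding b_def by (intro roe_bounded_ops hom_roe a)
  define h where "h = t *\<^sub>R (adj a o\<^sub>L a)"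
  have hR: "h \<in> uniform_roe"
    unfolding h_def by (intro subspace_scale[OF subspace_uniform_roe] roe_compose roe_adj a)
  have idR: "id_blinfun \<in> uniform_roe" using chi_in_roe[of UNIV] by (simp add: chi_UNIV)
  have \<Phi>h: "\<Phi> h = t *\<^sub>R (adj b o\<^sub>L b)"
    unfolding h_def b_def by (simp add: hom_scaleR hom_compose hom_adj roe_compose roe_adj a)
  have "norm h \<le> t * (norm a * norm a)"
    using norm_blinfun_compose[of "adj a" a] mult_right_mono[OF norm_adj_le[OF roe_bounded_ops[OF a]], of "norm a"] t(1)
    by (simp add: h_def)
  also have "\<dots> < t * (\<beta> * \<beta>)"
    using t(1) \<beta> by (intro mult_strict_left_mono mult_strict_mono') auto
  finally have h1: "norm h < 1" using t(2) by (simp add: power2_eq_square)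
  \<comment> \<open>The Neumann series of \<open>h\<close>, obtained as a fixed point.\<close>
  have "\<exists>!k. k \<in> uniform_roe \<and> id_blinfun + (k o\<^sub>L h) = k"
  proof (rule Banach_fix)
    show "complete (uniform_roe :: 'x ell2_op set)"
      using closed_uniform_roe by (simp add: complete_eq_closed)
    show "uniform_roe \<noteq> ({} :: 'x ell2_op set)" using idR by blast
    show "(\<lambda>k. id_blinfun + (k o\<^sub>L h)) ` uniform_roe \<subseteq> uniform_roe"
      using subspace_add[OF subspace_uniform_roe idR] roe_compose hR by blast
    show "dist (id_blinfun + (k o\<^sub>L h)) (id_blinfun + (k' o\<^sub>L h)) \<le> norm h * dist k k'" for k k' :: "'x ell2_op"
      using norm_blinfun_compose[of "k - k'" h]
      by (simp add: dist_norm mult.commute bounded_bilinear.diff_left[OF bounded_bilinear_blinfun_compose])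
  qed (use h1 in auto)
  then obtain k where kR: "k \<in> uniform_roe" and k: "k = id_blinfun + (k o\<^sub>L h)" by metis
  have k_id: "k o\<^sub>L id_blinfun = k" by (rule blinfun_eqI) simp
  have "\<Phi> k = \<Phi> id_blinfun + (\<Phi> k o\<^sub>L \<Phi> h)"
    using hom_add[OF idR roe_compose[OF kR hR]] hom_compose[OF kR hR] k[symmetric] by simp
  moreover have "\<Phi> k = \<Phi> k o\<^sub>L \<Phi> id_blinfun"
    using hom_compose[OF kR idR] by (simp add: k_id)
  ultimately have inv: "\<Phi> id_blinfun u = \<Phi> k (\<Phi> id_blinfun u - \<Phi> h u)" for u
    by (metis add_diff_cancel_right' blinfun.add_left blinfun.diff_right blinfun_apply_blinfun_compose)
  have prj: "projection (\<Phi> id_blinfun)" using projection_hom_chi[of UNIV] by (simp add: chi_UNIV)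
  \<comment> \<open>Adding one gives \<open>K \<ge> 1\<close>, which makes the root below real.\<close>
  define K where "K = norm (\<Phi> k) + 1"
  have K: "K > 0" "norm (\<Phi> k) \<le> K" by (auto simp: K_def add_nonneg_pos)
  define \<gamma> where "\<gamma> = sqrt (1 - 1 / K\<^sup>2)"
  have "1 \<le> K\<^sup>2" by (simp add: K_def one_le_power)
  then have \<gamma>: "0 \<le> \<gamma>" "\<gamma> < 1" using K(1) by (simp_all add: \<gamma>_def divide_le_eq_1)
  have tb2: "\<beta>\<^sup>2 * (t * y) = y" for y
  proof -
    have "\<beta>\<^sup>2 * (t * y) = (t * \<beta>\<^sup>2) * y" by simp
    then show ?thesis unfolding t(2) by simp
  qed
  have tb: "t * (\<beta> * y)\<^sup>2 = y\<^sup>2" for y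
    using tb2[of "y\<^sup>2"] by (simp add: power_mult_distrib mult.left_commute)
  have "norm (b u) \<le> \<beta> * \<gamma> * norm u" for u
  proof -
    define v where "v = \<Phi> id_blinfun u"
    have "a o\<^sub>L id_blinfun = a" by (rule blinfun_eqI) simp
    then have "b o\<^sub>L \<Phi> id_blinfun = b" using hom_compose[OF a idR] by (simp add: b_def)
    then have bv: "b v = b u" by (metis blinfun_apply_blinfun_compose v_def)
    have "\<Phi> id_blinfun o\<^sub>L \<Phi> id_blinfun = \<Phi> id_blinfun" using prj by (simp add: projection_def)
    then have vv: "\<Phi> id_blinfun v = v" by (metis blinfun_apply_blinfun_compose v_def)
    have nv: "norm v \<le> norm u" unfolding v_def by (rule projection_norm_le[OF prj])
    have hv: "\<Phi> h v = t *\<^sub>R adj b (b v)" by (simp add: \<Phi>h blinfun.scaleR_left)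
    have i: "inner v (adj b (b v)) = (norm (b v))\<^sup>2"
      using inner_adj[OF bB, of v "b v"] by (simp add: power2_norm_eq_inner)
    have "norm (adj b (b v)) \<le> \<beta> * norm (b v)"
      using norm_blinfun[of "adj b" "b v"] mult_right_mono[OF norm_adj_le[OF bB], of "norm (b v)"]
      by (simp add: \<beta>_def)
    then have "(norm (adj b (b v)))\<^sup>2 \<le> (\<beta> * norm (b v))\<^sup>2" by (intro power_mono) auto
    then have "t * (t * (norm (adj b (b v)))\<^sup>2) \<le> t * (t * (\<beta> * norm (b v))\<^sup>2)"
      using t(1) by (intro mult_left_mono) auto
    also have "\<dots> = t * (norm (b v))\<^sup>2"
      by (simp only: tb)
    finally have j: "t * (t * (norm (adj b (b v)))\<^sup>2) \<le> t * (norm (b v))\<^sup>2" .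
    have "(norm (v - \<Phi> h v))\<^sup>2 = (norm v)\<^sup>2 - 2 * (t * (norm (b v))\<^sup>2) + t * (t * (norm (adj b (b v)))\<^sup>2)"
      unfolding hv
      by (simp add: power2_norm_eq_inner inner_diff_left inner_diff_right i[unfolded power2_norm_eq_inner]
          inner_commute[of "adj b (b v)" v] algebra_simps)
    with j have 1: "(norm (v - \<Phi> h v))\<^sup>2 \<le> (norm v)\<^sup>2 - t * (norm (b v))\<^sup>2" by simp
    have "norm v = norm (\<Phi> k (v - \<Phi> h v))" using inv[of v] by (simp add: vv)
    also have "\<dots> \<le> K * norm (v - \<Phi> h v)"
      using norm_blinfun[of "\<Phi> k" "v - \<Phi> h v"] mult_right_mono[OF K(2), of "norm (v - \<Phi> h v)"] by simp
    finally have "(norm v)\<^sup>2 \<le> K\<^sup>2 * (norm (v - \<Phi> h v))\<^sup>2"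
      by (metis norm_ge_zero power_mono power_mult_distrib)
    also have "\<dots> \<le> K\<^sup>2 * ((norm v)\<^sup>2 - t * (norm (b v))\<^sup>2)" using 1 by (intro mult_left_mono) auto
    finally have "(norm v)\<^sup>2 / K\<^sup>2 \<le> (norm v)\<^sup>2 - t * (norm (b v))\<^sup>2"
      using K(1) by (simp add: divide_le_eq mult.commute)
    then have "t * (norm (b v))\<^sup>2 \<le> (1 - 1 / K\<^sup>2) * (norm v)\<^sup>2"
      by (simp add: left_diff_distrib)
    then have "\<beta>\<^sup>2 * (t * (norm (b v))\<^sup>2) \<le> \<beta>\<^sup>2 * ((1 - 1 / K\<^sup>2) * (norm v)\<^sup>2)"
      by (intro mult_left_mono) auto
    then have "(norm (b v))\<^sup>2 \<le> \<beta>\<^sup>2 * ((1 - 1 / K\<^sup>2) * (norm v)\<^sup>2)"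
      by (simp only: tb2)
    then have "sqrt ((norm (b v))\<^sup>2) \<le> sqrt (\<beta>\<^sup>2 * ((1 - 1 / K\<^sup>2) * (norm v)\<^sup>2))"
      by (rule real_sqrt_le_mono)
    also have "\<dots> = \<beta> * \<gamma> * norm v" using \<beta> by (simp add: real_sqrt_mult \<gamma>_def)
    finally have "norm (b v) \<le> \<beta> * \<gamma> * norm v" by simp
    also have "\<dots> \<le> \<beta> * \<gamma> * norm u"
      using nv \<beta>(1) \<gamma>(1) by (intro mult_left_mono) auto
    finally show ?thesis by (simp add: bv)
  qed
  then have "norm b \<le> \<beta> * \<gamma>" using \<beta>(1) \<gamma>(1) by (intro norm_blinfun_bound) auto
  then show False using \<gamma>(2) \<beta>(1) unfolding \<beta>_def[symmetric] by (simp add: mult_le_cancel_left1)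
qed

lemma tendsto_hom:
  assumes "\<And>n. a n \<in> uniform_roe" "l \<in> uniform_roe" "a \<longlonglongrightarrow> l"
  shows "(\<lambda>n. \<Phi> (a n)) \<longlonglongrightarrow> \<Phi> l"
proof (rule LIM_zero_cancel, rule Lim_null_comparison)
  show "(\<lambda>n. norm (a n - l)) \<longlonglongrightarrow> 0" using assms(3) by (intro tendsto_norm_zero LIM_zero)
  show "\<forall>\<^sub>F n in sequentially. norm (\<Phi> (a n) - \<Phi> l) \<le> norm (a n - l)"
    using hom_norm_le[OF subspace_diff[OF subspace_uniform_roe assms(1,2)]]
    by (simp add: hom_diff assms)
qed

text \<open>The additive set function \<open>A \<mapsto> \<Phi> \<chi>\<^sub>A\<close> is defined on all subsets of \<open>X\<close> and takes
  values in the closure of the banded operators.\<close>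

lemma hom_chi_uniformly_banded:
  assumes "\<epsilon> > 0"
  shows "\<exists>r. \<forall>F. finite F \<longrightarrow> infdist (\<Phi> (chi F)) (banded r) \<le> \<epsilon>"
proof -
  have "\<exists>n. \<forall>F. finite F \<longrightarrow> infdist (\<Phi> (chi F)) (banded (real n)) \<le> \<epsilon>"
  proof (rule uniform_approximation_on_finite_sets[where C = 1])
    show "\<Phi> (chi (A \<union> B)) = \<Phi> (chi A) + \<Phi> (chi B)" if "A \<inter> B = {}" for A B
      by (simp add: chi_Un[OF that] hom_add chi_in_roe)
    show "norm (\<Phi> (chi A)) \<le> 1" for A
      by (rule norm_blinfun_bound) (use projection_norm_le[OF projection_hom_chi] in auto)
    show "incseq (\<lambda>n. banded (real n) :: 'y ell2_op set)"
      by (simp add: incseq_def banded_mono)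
    show "\<Phi> (chi A) \<in> closure (\<Union>n. banded (real n))" for A
      using hom_roe[OF chi_in_roe] by (simp add: uniform_roe_eq)
  qed (use assms subspace_banded in auto)
  then show ?thesis by blast
qed

text \<open>The image of \<open>a\<close> maps the range of each \<open>\<Phi> \<chi>\<^sub>B\<close>, \<open>B\<close> a ball, into the range of another
  one, so the range of \<open>p\<close> is invariant; the second half of \<open>banded_chi\<close> gives invariance of the
  orthogonal complement.\<close>

lemma commute_with_limit:
  assumes a: "a \<in> banded r"
    and P: "\<And>n. p o\<^sub>L \<Phi> (chi (cball x (real n))) = \<Phi> (chi (cball x (real n)))"
      "\<And>n. \<Phi> (chi (cball x (real n))) o\<^sub>L p = \<Phi> (chi (cball x (real n)))"
    and lim: "\<And>u. (\<lambda>n. \<Phi> (chi (cball x (real n))) u) \<longlonglongrightarrow> p u"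
  shows "p o\<^sub>L \<Phi> a = \<Phi> a o\<^sub>L p"
proof -
  let ?P = "\<lambda>n. \<Phi> (chi (cball x (real n)))"
  obtain s where s: "r \<le> real s" using real_arch_simple by blast
  have near: "y \<in> cball x (real (n + s))" if "z \<in> cball x (real n)" "dist z y \<le> r" for y z n
    using that s dist_triangle[of x y z] by simp
  have aR: "a \<in> uniform_roe" by (rule banded_in_roe[OF a])
  have R: "?P (n + s) o\<^sub>L \<Phi> a o\<^sub>L ?P n = \<Phi> a o\<^sub>L ?P n" for n
    using banded_chi(1)[where A = "cball x (real n)" and B = "cball x (real (n + s))", OF a near]
    by (simp add: hom_compose[symmetric] aR chi_in_roe roe_compose)
  have L: "?P n o\<^sub>L \<Phi> a o\<^sub>L ?P (n + s) = ?P n o\<^sub>L \<Phi> a" for n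
    using banded_chi(2)[where A = "cball x (real n)" and B = "cball x (real (n + s))", OF a near]
    by (simp add: hom_compose[symmetric] aR chi_in_roe roe_compose)
  have "p (\<Phi> a (p u)) = \<Phi> a (p u)" for u
  proof (rule LIMSEQ_unique)
    have "p (\<Phi> a (?P n u)) = \<Phi> a (?P n u)" for n
      using R[of n] P(1)[of "n + s"] by (metis blinfun_apply_blinfun_compose)
    moreover show "(\<lambda>n. p (\<Phi> a (?P n u))) \<longlonglongrightarrow> p (\<Phi> a (p u))"
      by (intro blinfun.tendsto tendsto_const lim)
    moreover have "(\<lambda>n. \<Phi> a (?P n u)) \<longlonglongrightarrow> \<Phi> a (p u)"
      by (intro blinfun.tendsto tendsto_const lim)
    ultimately show "(\<lambda>n. p (\<Phi> a (?P n u))) \<longlonglongrightarrow> \<Phi> a (p u)" by simp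
  qed
  moreover have "p (\<Phi> a (p u)) = p (\<Phi> a u)" for u
  proof (rule LIMSEQ_unique)
    have "?P n (\<Phi> a (p u)) = ?P n (\<Phi> a u)" for n
      using L[of n] P(2)[of "n + s"] by (metis blinfun_apply_blinfun_compose)
    moreover show "(\<lambda>n. ?P n (\<Phi> a (p u))) \<longlonglongrightarrow> p (\<Phi> a (p u))" by (rule lim)
    moreover have "(\<lambda>n. ?P n (\<Phi> a u)) \<longlonglongrightarrow> p (\<Phi> a u)" by (rule lim)
    ultimately show "(\<lambda>n. ?P n (\<Phi> a (p u))) \<longlonglongrightarrow> p (\<Phi> a u)" by simp
  qed
  ultimately show ?thesis by (intro blinfun_eqI) simp
qed

lemma strong_limit_below_finite:
  assumes ak: "\<And>k. a k \<in> uniform_roe" and l: "l \<in> uniform_roe"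
    and lim: "\<And>u. (\<lambda>k. a k u) \<longlonglongrightarrow> l u" and F: "finite F"
  shows "(\<lambda>k. \<Phi> (a k) o\<^sub>L \<Phi> (chi F)) \<longlonglongrightarrow> (\<Phi> l o\<^sub>L \<Phi> (chi F))"
proof -
  have d: "a k - l \<in> uniform_roe" for k by (rule subspace_diff[OF subspace_uniform_roe ak l])
  have "(\<lambda>k. (a k - l) o\<^sub>L chi F) \<longlonglongrightarrow> 0"
    using lim by (intro chi_finite_SOT_norm F roe_bounded_ops d) (simp add: blinfun.diff_left LIM_zero)
  then have "(\<lambda>k. ((a k - l) o\<^sub>L chi F) + (l o\<^sub>L chi F)) \<longlonglongrightarrow> 0 + (l o\<^sub>L chi F)"
    by (rule tendsto_add) simp
  then have "(\<lambda>k. a k o\<^sub>L chi F) \<longlonglongrightarrow> (l o\<^sub>L chi F)"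
    by (simp add: bounded_bilinear.diff_left[OF bounded_bilinear_blinfun_compose])
  from tendsto_hom[OF _ _ this] show ?thesis
    by (simp add: roe_compose ak l chi_in_roe hom_compose)
qed

end

section \<open>The strongly continuous part of an embedding\<close>

theorem theorem4p3:
  fixes \<Phi> :: "'x::metric_space ell2_op \<Rightarrow> 'y::metric_space ell2_op"
  assumes "uniformly_locally_finite TYPE('x)"
    and "uniformly_locally_finite TYPE('y)"
    and "roe_embedding \<Phi>"
    and "compact_preserving \<Phi> \<or> property_A TYPE('y)"
  shows "\<exists>p \<in> uniform_roe. projection p \<and>
    (\<forall>a\<in>uniform_roe. p o\<^sub>L \<Phi> a = \<Phi> a o\<^sub>L p) \<and>
    star_hom uniform_roe uniform_roe (\<lambda>a. p o\<^sub>L \<Phi> a o\<^sub>L p) \<and>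
    strongly_continuous (\<lambda>a. p o\<^sub>L \<Phi> a o\<^sub>L p) \<and>
    (\<exists>a\<in>uniform_roe. p o\<^sub>L \<Phi> a o\<^sub>L p \<noteq> 0)"
proof -
  have hom: "star_hom uniform_roe uniform_roe \<Phi>" and inj: "inj_on \<Phi> uniform_roe"
    using assms(3) by (auto simp: roe_embedding_def)
  note hom_rules = hom_roe[OF hom] hom_add[OF hom] hom_scaleC[OF hom] hom_compose[OF hom] hom_adj[OF hom]
  obtain x :: 'x where True by simp
  define P where "P n = \<Phi> (chi (cball x (real n)))" for n
  have P: "projection (P n)" for n unfolding P_def by (rule projection_hom_chi[OF hom])
  have "P m o\<^sub>L P n = P n \<and> P n o\<^sub>L P m = P n" if "n \<le> m" for m n
  proof -
    have "cball x (real n) \<subseteq> cball x (real m)" using that by (intro subset_cball) simp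
    then have "cball x (real m) \<inter> cball x (real n) = cball x (real n)"
      "cball x (real n) \<inter> cball x (real m) = cball x (real n)" by blast+
    then show ?thesis by (simp add: P_def hom_rules(4)[symmetric] chi_in_roe chi_compose)
  qed
  from increasing_projections_limit[of P, OF P this]
  obtain p where p: "projection p" and lim: "\<And>u. (\<lambda>n. P n u) \<longlonglongrightarrow> p u"
    and pP: "\<And>n. p o\<^sub>L P n = P n" and Pp: "\<And>n. P n o\<^sub>L p = P n"
    by blast
  have fin: "finite (cball x r)" for r by (rule ulf_finite_cball[OF assms(1)])
  have pR: "p \<in> uniform_roe"
  proof (rule roe_if_uniformly_banded[OF assms(2) _ lim])
    show "norm (P n) \<le> 1" for n
      by (rule norm_blinfun_bound) (use projection_norm_le[OF P] in auto)
    show "\<exists>r. \<forall>n. infdist (P n) (banded r) \<le> \<epsilon>" if "\<epsilon> > 0" for \<epsilon>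
      using hom_chi_uniformly_banded[OF hom that] fin unfolding P_def by blast
  qed
  have pp: "p o\<^sub>L p = p" and adjp: "adj p = p" and pB: "p \<in> bounded_ops"
    using p by (auto simp: projection_def)
  have com: "p o\<^sub>L \<Phi> a = \<Phi> a o\<^sub>L p" if a: "a \<in> uniform_roe" for a
  proof -
    obtain b r where b: "\<And>n. b n \<in> banded (r n)" "b \<longlonglongrightarrow> a" using a by (rule roe_limit_of_banded) blast
    have eq: "p o\<^sub>L \<Phi> (b n) = \<Phi> (b n) o\<^sub>L p" for n
      by (rule commute_with_limit[OF hom b(1), where x = x]) (use pP Pp lim in \<open>simp_all add: P_def\<close>)
    have l: "(\<lambda>n. \<Phi> (b n)) \<longlonglongrightarrow> \<Phi> a"
      by (rule tendsto_hom[OF hom _ a b(2)]) (rule banded_in_roe[OF b(1)])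
    note bl = bounded_bilinear.tendsto[OF bounded_bilinear_blinfun_compose]
    show ?thesis
      using bl[OF tendsto_const[of p] l] bl[OF l tendsto_const[of p]] unfolding eq
      by (rule LIMSEQ_unique)
  qed
  have com': "p (\<Phi> a u) = \<Phi> a (p u)" if "a \<in> uniform_roe" for a u
    using com[OF that] by (metis blinfun_apply_blinfun_compose)
  have pp': "p (p u) = p u" for u
    using pp by (metis blinfun_apply_blinfun_compose)
  have "star_hom uniform_roe uniform_roe (\<lambda>a. p o\<^sub>L \<Phi> a o\<^sub>L p)"
    unfolding star_hom_def
  proof (intro conjI ballI allI)
    show "(\<lambda>a. p o\<^sub>L \<Phi> a o\<^sub>L p) ` uniform_roe \<subseteq> uniform_roe"
      using roe_compose[OF roe_compose[OF pR hom_rules(1)] pR] by blast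
    fix a b :: "'x ell2_op" and c
    assume a: "a \<in> uniform_roe"
    show "p o\<^sub>L \<Phi> (scaleC_op c a) o\<^sub>L p = scaleC_op c (p o\<^sub>L \<Phi> a o\<^sub>L p)"
      by (rule blinfun_eqI) (simp add: hom_rules(3) a scaleC_op_apply bounded_opsD[OF pB])
    show "p o\<^sub>L \<Phi> (adj a) o\<^sub>L p = adj (p o\<^sub>L \<Phi> a o\<^sub>L p)"
      using roe_bounded_ops[OF hom_rules(1)[OF a]] pB
      by (simp add: adj_compose bounded_ops_compose adjp hom_rules(5) a compose_assoc)
    assume b: "b \<in> uniform_roe"
    show "p o\<^sub>L \<Phi> (a + b) o\<^sub>L p = (p o\<^sub>L \<Phi> a o\<^sub>L p) + (p o\<^sub>L \<Phi> b o\<^sub>L p)"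
      by (rule blinfun_eqI) (simp add: hom_rules(2) a b blinfun.add_left blinfun.add_right)
    show "p o\<^sub>L \<Phi> (a o\<^sub>L b) o\<^sub>L p = (p o\<^sub>L \<Phi> a o\<^sub>L p) o\<^sub>L (p o\<^sub>L \<Phi> b o\<^sub>L p)"
      by (rule blinfun_eqI) (simp add: hom_rules(4) a b com' pp')
  qed
  moreover have "strongly_continuous (\<lambda>a. p o\<^sub>L \<Phi> a o\<^sub>L p)"
    unfolding strongly_continuous_def limitin_SOT_iff
  proof (intro allI impI, elim conjE)
    fix a :: "nat \<Rightarrow> 'x ell2_op" and l u
    assume ak: "\<forall>k. a k \<in> uniform_roe" and l: "l \<in> uniform_roe" and al: "\<forall>u. (\<lambda>k. a k u) \<longlonglongrightarrow> l u"
    have "bounded (range (\<lambda>k. a k v))" for v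
      using al by (intro convergent_imp_bounded) blast
    then obtain K where K: "\<And>k. norm (a k) \<le> K" by (rule uniform_boundedness) blast
    have K0: "K \<ge> 0" using K[of 0] order.trans[OF norm_ge_zero] by blast
    have Kd: "norm (\<Phi> (a k) v - \<Phi> l v) \<le> (K + norm l) * norm v" for k v
    proof -
      have "norm (\<Phi> (a k) - \<Phi> l) \<le> norm (\<Phi> (a k)) + norm (\<Phi> l)" by (rule norm_triangle_ineq4)
      also have "\<dots> \<le> K + norm l"
        using hom_norm_le[OF hom] ak l K[of k] by (meson add_mono order.trans)
      finally show ?thesis
        using norm_blinfun[of "\<Phi> (a k) - \<Phi> l" v] mult_right_mono[of "norm (\<Phi> (a k) - \<Phi> l)" "K + norm l" "norm v"]
        by (simp add: blinfun.diff_left)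
    qed
    \<comment> \<open>The added one makes \<open>M\<close> positive also when all operators vanish.\<close>
    define M where "M = K + norm l + 1"
    have M: "M > 0" using K0 by (simp add: M_def add_nonneg_pos)
    have "(\<lambda>k. \<Phi> (a k) (p u)) \<longlonglongrightarrow> \<Phi> l (p u)"
      unfolding LIMSEQ_iff
    proof (intro allI impI)
      \<comment> \<open>On the range of \<open>P n\<close> convergence is in norm; the rest of \<open>p u\<close> is small uniformly in \<open>k\<close>.\<close>
      fix e :: real assume e: "e > 0"
      then obtain n where n: "norm (P n u - p u) < e / (2 * M)"
        using LIMSEQ_D[OF lim, of "e / (2 * M)" u] M by (metis divide_pos_pos mult_pos_pos order_refl zero_less_numeral)
      have "(\<lambda>k. \<Phi> (a k) o\<^sub>L P n) \<longlonglongrightarrow> (\<Phi> l o\<^sub>L P n)"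
        unfolding P_def by (rule strong_limit_below_finite[OF hom]) (use ak al l fin in simp_all)
      from blinfun.tendsto[OF this tendsto_const[of u]]
      have "(\<lambda>k. (\<Phi> (a k) o\<^sub>L P n) u) \<longlonglongrightarrow> (\<Phi> l o\<^sub>L P n) u" .
      then obtain N where N: "\<And>k. k \<ge> N \<Longrightarrow> norm (\<Phi> (a k) (P n u) - \<Phi> l (P n u)) < e / 2"
        using e LIMSEQ_D[of "\<lambda>k. \<Phi> (a k) (P n u)" "\<Phi> l (P n u)" "e / 2"] by auto
      have "norm (\<Phi> (a k) (p u) - \<Phi> l (p u)) < e" if "k \<ge> N" for k
      proof -
        let ?v = "p u - P n u"
        have "norm (\<Phi> (a k) ?v - \<Phi> l ?v) \<le> M * norm ?v"
          by (rule order.trans[OF Kd mult_right_mono]) (auto simp: M_def)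
        also have "\<dots> < M * (e / (2 * M))"
          using n M by (intro mult_strict_left_mono) (simp_all add: norm_minus_commute)
        also have "\<dots> = e / 2" using M by simp
        finally have "norm (\<Phi> (a k) ?v - \<Phi> l ?v) < e / 2" .
        moreover have "\<Phi> (a k) (p u) - \<Phi> l (p u)
            = (\<Phi> (a k) ?v - \<Phi> l ?v) + (\<Phi> (a k) (P n u) - \<Phi> l (P n u))"
          by (simp add: blinfun.diff_right)
        ultimately show ?thesis
          using N[OF that] norm_triangle_ineq[of "\<Phi> (a k) ?v - \<Phi> l ?v" "\<Phi> (a k) (P n u) - \<Phi> l (P n u)"]
          by simp
      qed
      then show "\<exists>N. \<forall>k\<ge>N. norm (\<Phi> (a k) (p u) - \<Phi> l (p u)) < e" by blast
    qed
    from blinfun.tendsto[OF tendsto_const[of p] this]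
    show "(\<lambda>k. (p o\<^sub>L \<Phi> (a k) o\<^sub>L p) u) \<longlonglongrightarrow> (p o\<^sub>L \<Phi> l o\<^sub>L p) u" by simp
  qed
  moreover have "p o\<^sub>L \<Phi> (chi {x}) o\<^sub>L p \<noteq> 0"
  proof
    assume "p o\<^sub>L \<Phi> (chi {x}) o\<^sub>L p = 0"
    moreover have "P 0 = \<Phi> (chi {x})" by (simp add: P_def)
    ultimately have "\<Phi> (chi {x}) = 0" using pP[of 0] Pp[of 0] by simp
    also have "0 = \<Phi> 0" using hom_diff[OF hom, of 0 0] subspace_0[OF subspace_uniform_roe] by simp
    finally have "\<Phi> (chi {x}) = \<Phi> 0" .
    from inj_onD[OF inj this chi_in_roe subspace_0[OF subspace_uniform_roe]]
    show False using chi_nonzero[of x] by simp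
  qed
  ultimately show ?thesis using pR p com chi_in_roe[of "{x}"] by (intro bexI[of _ p] conjI ballI) auto
qed

end
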